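(* For $k=1,2$ let $T_k$ be an m-sectorial operator in a Hilbert space $(\mathcal H_k,(\cdot,\cdot)_k)$, let $J_k$ be a bounded symmetric involution in $\mathcal H_k$, and let $J:=J_1\otimes J_2$. Assume that there exist (bounded, not necessarily orthogonal) projections $P_k^{+},P_k^{-}$ in $\mathcal H_k$ and constants $\varkappa_k^{\pm}>0$, $k=1,2$, such that: (1) $P_k^\mu P_k^\nu=\delta_{\mu\nu}P_k^\mu$ for $\mu,\nu\in\{+,-\}$, $k=1,2$; (2) $T_kP_k^\mu\supset P_k^\mu T_k$ for $\mu\in\{+,-\}$, $k=1,2$; (3) for all $f_k\in\mathcal H_k^\pm:=P_k^\pm\mathcal H_k$ one has $\pm(J_kf_k,f_k)_k\ge\varkappa_k^\pm\|f_k\|_k^2$, $k=1,2$. Let the operators $\mathsf S$, $\mathsf S^{\mu\nu}$ ($\mu,\nu\in\{+,-,\mathrm r\}$), $\mathsf S^+$, $\mathsf S^-$ and $\mathsf S^{\mathrm r}$ be those constructed from $T_k$ and $P_k^\pm$ as described in the context, and let $\sigma_{++}(\mathsf S)$ and $\sigma_{--}(\mathsf S)$ be defined with respect to $J$. Then for $\mu,\nu\in\{+,-\}$ with $\mu\neq\nu$ the following hold. (i) $\sigma_{\rm app}(\mathsf S^{\mu\mu})\setminus\big(\sigma(\mathsf S^-)\cup\sigma(\mathsf S^{\mathrm r})\cup\sigma(\mathsf S^{\nu\nu})\big)\subset\sigma_{++}(\mathsf S)$. (ii) $\sigma_{\rm app}(\mathsf S^{\mu\nu})\setminus\big(\sigma(\mathsf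 S^+)\cup\sigma(\mathsf S^{\mathrm r})\cup\sigma(\mathsf S^{\nu\mu})\big)\subset\sigma_{--}(\mathsf S)$. (iii) If, in addition, there exist constants $\varkappa_k^{+-}\ge 0$, $k=1,2$, such that $$|(J_kf_k^+,f_k^-)_k|\le\varkappa_k^{+-}\|f_k^+\|_k\|f_k^-\|_k\qquad\text{for all } f_k^\pm\in\mathcal H_k^\pm,$$ and, moreover, $(\varkappa_1^{+-}\varkappa_2^{+-})^2<\varkappa_1^+\varkappa_2^+\varkappa_1^-\varkappa_2^-$, then $$\sigma_{\rm app}(\mathsf S^\mu)\setminus\big(\sigma(\mathsf S^\nu)\cup\sigma(\mathsf S^{\mathrm r})\big)\subset\sigma_{\mu\mu}(\mathsf S).$$
   Context: A bounded symmetric involution $J$ in a Hilbert space is a bounded operator with $J=J^*$ and $J^2=I$. For a densely defined closed operator $T$ in a Hilbert space $\mathcal H$, $\sigma(T)$ is its spectrum and $\sigma_{\rm app}(T)$ its approximate point spectrum, i.e. the set of $\lambda\in\mathbb C$ for which there is an approximate eigensequence: $\{f_n\}_n\subset\operatorname{dom}T$, $\|f_n\|=1$, $\|(T-\lambda)f_n\|\to0$. Given $J$, a point $\lambda\in\sigma_{\rm app}(T)$ belongs to $\sigma_{++}(T)$ (positive type) if every approximate eigensequence $\{f_n\}_n$ of $T$ corresponding to $\lambda$ satisfies $\liminf_n(Jf_n,f_n)>0$, and to $\sigma_{--}(T)$ (negative type) if every such sequence satisfies $\limsup_n(Jf_n,f_n)<0$. $\odot$ denotes the algebraic (pre-)tensor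 product of operators and $\otimes$ the (completed) tensor product of Hilbert spaces and of bounded operators. Set $S:=T_1\odot I_2+I_1\odot T_2$ in $\mathcal H:=\mathcal H_1\otimes\mathcal H_2$; it is closable and its closure $\mathsf S:=\overline S$ is m-sectorial. Put $P_k^{\mathrm r}:=I_{\mathcal H_k}-P_k^+-P_k^-$, $\mathcal H_k^\mu:=P_k^\mu\mathcal H_k$ for $\mu\in\mathcal I:=\{+,-,\mathrm r\}$, so that $\mathcal H_k=\mathcal H_k^+\dotplus\mathcal H_k^-\dotplus\mathcal H_k^{\mathrm r}$ (direct sum). Let $T_k^\mu$ be the (closed) restriction of $T_k$ to $\operatorname{dom}T_k^\mu:=\operatorname{dom}T_k\cap\mathcal H_k^\mu$, regarded as an operator in $\mathcal H_k^\mu$, and let $I_k^\mu$ be the identity in $\mathcal H_k^\mu$. For $\mu,\nu\in\mathcal I$, let $\mathcal H^{\mu\nu}:=\mathcal H_1^\mu\otimes\mathcal H_2^\nu$ and $$\mathsf S^{\mu\nu}:=\overline{T_1^\mu\odot I_2^\nu+I_1^\mu\odot T_2^\nu}\quad\text{in }\mathcal H^{\mu\nu}$$ (these closures are m-sectorial). Let $\Theta_k:=\sum_{\mu\in\mathcal I}(P_k^\mu)^*P_k^\mu$, $\Phi:=\Theta_1\otimes\Theta_2$; $\Phi$ is bounded and uniformly positive, and $(\cdot,\cdot)_\Phi:=(\Phi\cdot,\cdot)$ is a scalar product on $\mathcal H$ equivalent to the original one, with respect to which the nine subspaces $\mathcal H^{\mu\nu}$ are mutually orthogonal and span $\mathcal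 H$. Writing $\oplus_\Phi$ for orthogonal sums with respect to $(\cdot,\cdot)_\Phi$, one has $\mathsf S=\bigoplus_{\Phi}^{\mu,\nu\in\mathcal I}\mathsf S^{\mu\nu}$, and one defines $$\mathsf S^{\mathrm r}:=\mathsf S^{\mathrm r+}\oplus_\Phi\mathsf S^{\mathrm r-}\oplus_\Phi\mathsf S^{\mathrm r\mathrm r}\oplus_\Phi\mathsf S^{+\mathrm r}\oplus_\Phi\mathsf S^{-\mathrm r},\quad \mathsf S^+:=\mathsf S^{++}\oplus_\Phi\mathsf S^{--},\quad \mathsf S^-:=\mathsf S^{+-}\oplus_\Phi\mathsf S^{-+}.$$ An operator in the trivial space $\{0\}$ has empty spectrum. *)

theory Defs
  imports "HOL-Analysis.Analysis"
begin

section \<open>Complex Hilbert spaces\<close>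

class complex_vector = real_vector +
  fixes scaleC :: "complex \<Rightarrow> 'a \<Rightarrow> 'a"  (infixr "*\<^sub>C" 75)
  assumes scaleC_add_right: "c *\<^sub>C (x + y) = c *\<^sub>C x + c *\<^sub>C y"
    and scaleC_add_left: "(c + d) *\<^sub>C x = c *\<^sub>C x + d *\<^sub>C x"
    and scaleC_scaleC: "c *\<^sub>C d *\<^sub>C x = (c * d) *\<^sub>C x"
    and scaleC_of_real: "complex_of_real r *\<^sub>C x = r *\<^sub>R x"

text \<open>The inner product is linear in its first and conjugate-linear in its second argument.
  Nonnegativity and definiteness follow from \<open>norm_eq_sqrt_cinner\<close>, since
  \<^const>\<open>sqrt\<close> is negative on negative reals. The zero space is not excluded.\<close>

class complex_inner = complex_vector + real_normed_vector +
  fixes cinner :: "'a \<Rightarrow> 'a \<Rightarrow> complex"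
  assumes cinner_add_left: "cinner (x + y) z = cinner x z + cinner y z"
    and cinner_scaleC_left: "cinner (c *\<^sub>C x) y = c * cinner x y"
    and cinner_commute: "cinner x y = cnj (cinner y x)"
    and norm_eq_sqrt_cinner: "norm x = sqrt (Re (cinner x x))"

class chilbert_space = complex_inner + complete_space

global_interpretation complex_vector: vector_space "scaleC :: complex \<Rightarrow> 'a \<Rightarrow> 'a::complex_vector"
  defines csubspace = complex_vector.subspace
    and cspan = complex_vector.span
proof
  fix x :: 'a
  show "1 *\<^sub>C x = x"
    using scaleC_of_real[of 1 x] by simp
qed (simp_all add: scaleC_add_right scaleC_add_left scaleC_scaleC)

instantiation complex :: chilbert_space
begin

definition scaleC_complex :: "complex \<Rightarrow> complex \<Rightarrow> complex"
  where "scaleC_complex c x = c * x"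

definition cinner_complex :: "complex \<Rightarrow> complex \<Rightarrow> complex"
  where "cinner_complex x y = x * cnj y"

instance
  by standard
    (simp_all add: scaleC_complex_def cinner_complex_def algebra_simps scaleR_conv_of_real
      cmod_power2 [symmetric] power2_eq_square [symmetric] complex_norm_square [symmetric]
      del: of_real_power)

end

instantiation prod :: (complex_vector, complex_vector) complex_vector
begin

definition scaleC_prod :: "complex \<Rightarrow> 'a \<times> 'b \<Rightarrow> 'a \<times> 'b"
  where "scaleC_prod c x = (c *\<^sub>C fst x, c *\<^sub>C snd x)"

instance
  by standard
    (simp_all add: scaleC_prod_def prod_eq_iff scaleC_add_right scaleC_add_left scaleC_scaleC
      scaleC_of_real)

end

definition bounded_clinear :: "('a::complex_inner \<Rightarrow> 'b::complex_inner) \<Rightarrow> bool"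
  where "bounded_clinear A \<longleftrightarrow> bounded_linear A \<and> (\<forall>c f. A (c *\<^sub>C f) = c *\<^sub>C A f)"

definition symmetric_involution :: "('a::complex_inner \<Rightarrow> 'a) \<Rightarrow> bool"
  where "symmetric_involution J \<longleftrightarrow>
    bounded_clinear J \<and> (\<forall>f g. cinner (J f) g = cinner f (J g)) \<and> J \<circ> J = id"

definition fun_graph :: "('a \<Rightarrow> 'b) \<Rightarrow> ('a \<times> 'b) set"
  where "fun_graph A = {(f, A f) | f. True}"


section \<open>Unbounded operators\<close>

text \<open>An operator in a closed subspace of the ambient Hilbert space consists of that subspace and
  the graph of the operator. The closure of an operator is the closure of its graph, and
  \<open>A \<subseteq> B\<close> for operators is inclusion of graphs. The product \<open>A B\<close> has graph
  \<open>op_graph B O op_graph A\<close>.\<close>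

datatype 'a operator = Operator (op_space: "'a set") (op_graph: "('a \<times> 'a) set")

definition linear_operator :: "'a::chilbert_space operator \<Rightarrow> bool"
  where "linear_operator T \<longleftrightarrow>
    csubspace (op_space T) \<and> closed (op_space T) \<and>
    csubspace (op_graph T) \<and> single_valued (op_graph T) \<and>
    op_graph T \<subseteq> op_space T \<times> op_space T"

definition densely_defined :: "'a::chilbert_space operator \<Rightarrow> bool"
  where "densely_defined T \<longleftrightarrow> op_space T \<subseteq> closure (Domain (op_graph T))"

definition closed_operator :: "'a::chilbert_space operator \<Rightarrow> bool"
  where "closed_operator T \<longleftrightarrow> linear_operator T \<and> closed (op_graph T)"

definition op_shift :: "'a::chilbert_space operator \<Rightarrow> complex \<Rightarrow> 'a operator"  \<comment> \<open>\<open>T - z\<close>\<close>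
  where "op_shift T z = Operator (op_space T) {(f, g - z *\<^sub>C f) | f g. (f, g) \<in> op_graph T}"

text \<open>The inverse exists on the whole space and has norm at most \<open>C\<close>.\<close>

definition has_inverse_bound :: "'a::chilbert_space operator \<Rightarrow> real \<Rightarrow> bool"
  where "has_inverse_bound T C \<longleftrightarrow>
    single_valued ((op_graph T)\<inverse>) \<and> Range (op_graph T) = op_space T \<and>
    (\<forall>(f, g) \<in> op_graph T. norm f \<le> C * norm g)"

definition resolvent_set :: "'a::chilbert_space operator \<Rightarrow> complex set"
  where "resolvent_set T = {z. \<exists>C. has_inverse_bound (op_shift T z) C}"

definition spectrum :: "'a::chilbert_space operator \<Rightarrow> complex set"
  where "spectrum T = - resolvent_set T"

definition approx_eigenseq ::
    "'a::chilbert_space operator \<Rightarrow> complex \<Rightarrow> (nat \<Rightarrow> 'a) \<Rightarrow> bool"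
  where "approx_eigenseq T z f \<longleftrightarrow>
    (\<forall>n. norm (f n) = 1) \<and>
    (\<exists>g. (\<forall>n. (f n, g n) \<in> op_graph T) \<and> (\<lambda>n. norm (g n - z *\<^sub>C f n)) \<longlonglongrightarrow> 0)"

definition app_spectrum :: "'a::chilbert_space operator \<Rightarrow> complex set"
  where "app_spectrum T = {z. \<exists>f. approx_eigenseq T z f}"

definition numerical_range :: "'a::chilbert_space operator \<Rightarrow> complex set"
  where "numerical_range T = {cinner g f | f g. (f, g) \<in> op_graph T \<and> norm f = 1}"

text \<open>Accretivity and sectoriality in the sense of Kato. Note that \<open>Arg 0 = 0\<close>, so that the
  vertex belongs to the sector.\<close>

definition m_accretive :: "'a::chilbert_space operator \<Rightarrow> bool"
  where "m_accretive T \<longleftrightarrow>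
    (\<forall>z. Re z > 0 \<longrightarrow> has_inverse_bound (op_shift T (- z)) (1 / Re z))"

definition quasi_m_accretive :: "'a::chilbert_space operator \<Rightarrow> bool"
  where "quasi_m_accretive T \<longleftrightarrow> (\<exists>a::real. m_accretive (op_shift T (complex_of_real a)))"

definition sectorial :: "'a::chilbert_space operator \<Rightarrow> bool"
  where "sectorial T \<longleftrightarrow>
    (\<exists>\<gamma> \<theta>::real. 0 \<le> \<theta> \<and> \<theta> < pi / 2 \<and>
      numerical_range T \<subseteq> {z. \<bar>Arg (z - complex_of_real \<gamma>)\<bar> \<le> \<theta>})"

definition m_sectorial :: "'a::chilbert_space operator \<Rightarrow> bool"
  where "m_sectorial T \<longleftrightarrow>
    closed_operator T \<and> densely_defined T \<and> sectorial T \<and> quasi_m_accretive T"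

definition op_id :: "'a::chilbert_space set \<Rightarrow> 'a operator"
  where "op_id M = Operator M (Id_on M)"

definition op_restrict :: "'a::chilbert_space operator \<Rightarrow> 'a set \<Rightarrow> 'a operator"
  where "op_restrict T M = Operator M {(f, g) \<in> op_graph T. f \<in> M}"

definition op_closure :: "'a::chilbert_space operator \<Rightarrow> 'a operator"
  where "op_closure T = Operator (op_space T) (closure (op_graph T))"

definition op_add :: "'a::chilbert_space operator \<Rightarrow> 'a operator \<Rightarrow> 'a operator"
  where "op_add A B =
    Operator (op_space A) {(f, g + h) | f g h. (f, g) \<in> op_graph A \<and> (f, h) \<in> op_graph B}"

text \<open>The sum of operators in two subspaces with trivial intersection, acting componentwise. If
  these subspaces are orthogonal for some equivalent scalar product, such as
  \<open>(\<Phi> f, g)\<close> with \<open>\<Phi> = \<Theta>\<^sub>1 \<otimes> \<Theta>\<^sub>2\<close> and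
  \<open>\<Theta>\<^sub>k\<close> the sum of the \<open>P\<^sup>* P\<close> over the complementary projections in
  the \<open>k\<close>-th factor, this is the orthogonal sum; neither the operator nor its spectra depend on
  the scalar product.\<close>

definition op_dsum :: "'a::chilbert_space operator \<Rightarrow> 'a operator \<Rightarrow> 'a operator"
    (infixl "\<oplus>\<^sub>o" 65)
  where "A \<oplus>\<^sub>o B =
    Operator {f + f' | f f'. f \<in> op_space A \<and> f' \<in> op_space B}
      {(f + f', g + g') | f g f' g'. (f, g) \<in> op_graph A \<and> (f', g') \<in> op_graph B}"


section \<open>Spectra of definite type\<close>

datatype sign = Pos | Neg

text \<open>For symmetric \<open>J\<close> the number \<open>cinner (J f) f\<close> is real.\<close>

definition def_spectrum ::
    "sign \<Rightarrow> ('a::chilbert_space \<Rightarrow> 'a) \<Rightarrow> 'a operator \<Rightarrow> complex set"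
  where "def_spectrum \<mu> J T = {z \<in> app_spectrum T. \<forall>f. approx_eigenseq T z f \<longrightarrow>
    (case \<mu> of
      Pos \<Rightarrow> liminf (\<lambda>n. ereal (Re (cinner (J (f n)) (f n)))) > 0
    | Neg \<Rightarrow> limsup (\<lambda>n. ereal (Re (cinner (J (f n)) (f n)))) < 0)}"


section \<open>Tensor products\<close>

text \<open>The Hilbert space tensor product, determined up to unitary equivalence: the target is a
  Hilbert space which is a completion of the algebraic tensor product for the scalar product that is
  multiplicative on simple tensors. Injectivity of the algebraic tensor product into the target is
  a consequence of the multiplicativity.\<close>

definition hilbert_tensor_product ::
    "('a::chilbert_space \<Rightarrow> 'b::chilbert_space \<Rightarrow> 'c::chilbert_space) \<Rightarrow> bool"
  where "hilbert_tensor_product tens \<longleftrightarrow>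
    (\<forall>f f' g. tens (f + f') g = tens f g + tens f' g) \<and>
    (\<forall>f g g'. tens f (g + g') = tens f g + tens f g') \<and>
    (\<forall>c f g. tens (c *\<^sub>C f) g = c *\<^sub>C tens f g) \<and>
    (\<forall>c f g. tens f (c *\<^sub>C g) = c *\<^sub>C tens f g) \<and>
    (\<forall>f g f' g'. cinner (tens f g) (tens f' g') = cinner f f' * cinner g g') \<and>
    closure (cspan {tens f g | f g. True}) = UNIV"

definition tensor_bounded ::
    "('a::chilbert_space \<Rightarrow> 'b::chilbert_space \<Rightarrow> 'c::chilbert_space) \<Rightarrow>
      ('a \<Rightarrow> 'a) \<Rightarrow> ('b \<Rightarrow> 'b) \<Rightarrow> 'c \<Rightarrow> 'c"
  where "tensor_bounded tens A B =
    (THE C. bounded_clinear C \<and> (\<forall>f g. C (tens f g) = tens (A f) (B g)))"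

definition tensor_subspace ::
    "('a::chilbert_space \<Rightarrow> 'b::chilbert_space \<Rightarrow> 'c::chilbert_space) \<Rightarrow>
      'a set \<Rightarrow> 'b set \<Rightarrow> 'c set"
  where "tensor_subspace tens M N = closure (cspan {tens f g | f g. f \<in> M \<and> g \<in> N})"

text \<open>The algebraic tensor product of operators, with domain the algebraic tensor product of the
  domains. The span is taken in the product space, that is, over graphs.\<close>

definition op_alg_tensor ::
    "('a::chilbert_space \<Rightarrow> 'b::chilbert_space \<Rightarrow> 'c::chilbert_space) \<Rightarrow>
      'a operator \<Rightarrow> 'b operator \<Rightarrow> 'c operator"
  where "op_alg_tensor tens A B =
    Operator (tensor_subspace tens (op_space A) (op_space B))
      (cspan {(tens f f', tens g g') | f g f' g'. (f, g) \<in> op_graph A \<and> (f', g') \<in> op_graph B})"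

definition op_tensor_sum ::
    "('a::chilbert_space \<Rightarrow> 'b::chilbert_space \<Rightarrow> 'c::chilbert_space) \<Rightarrow>
      'a operator \<Rightarrow> 'b operator \<Rightarrow> 'c operator"
  where "op_tensor_sum tens A B =
    op_closure (op_add (op_alg_tensor tens A (op_id (op_space B)))
      (op_alg_tensor tens (op_id (op_space A)) B))"


section \<open>Decomposition with respect to the projections\<close>

datatype part = Sgn sign | Rest

fun part_proj :: "(sign \<Rightarrow> 'a::chilbert_space \<Rightarrow> 'a) \<Rightarrow> part \<Rightarrow> 'a \<Rightarrow> 'a" where
  "part_proj P (Sgn \<mu>) f = P \<mu> f"
| "part_proj P Rest f = f - P Pos f - P Neg f"

definition part_op ::
    "(sign \<Rightarrow> 'a::chilbert_space \<Rightarrow> 'a) \<Rightarrow> 'a operator \<Rightarrow> part \<Rightarrow> 'a operator"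
  where "part_op P T \<mu> = op_restrict T (range (part_proj P \<mu>))"

definition S_part ::
    "('a::chilbert_space \<Rightarrow> 'b::chilbert_space \<Rightarrow> 'c::chilbert_space) \<Rightarrow>
      'a operator \<Rightarrow> 'b operator \<Rightarrow> (sign \<Rightarrow> 'a \<Rightarrow> 'a) \<Rightarrow> (sign \<Rightarrow> 'b \<Rightarrow> 'b) \<Rightarrow>
      part \<Rightarrow> part \<Rightarrow> 'c operator"
  where "S_part tens T1 T2 P1 P2 \<mu> \<nu> = op_tensor_sum tens (part_op P1 T1 \<mu>) (part_op P2 T2 \<nu>)"

definition S_sign ::
    "('a::chilbert_space \<Rightarrow> 'b::chilbert_space \<Rightarrow> 'c::chilbert_space) \<Rightarrow>
      'a operator \<Rightarrow> 'b operator \<Rightarrow> (sign \<Rightarrow> 'a \<Rightarrow> 'a) \<Rightarrow> (sign \<Rightarrow> 'b \<Rightarrow> 'b) \<Rightarrow>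
      sign \<Rightarrow> 'c operator"
  where "S_sign tens T1 T2 P1 P2 \<mu> =
    (let S = (\<lambda>\<alpha> \<beta>. S_part tens T1 T2 P1 P2 (Sgn \<alpha>) (Sgn \<beta>))
     in case \<mu> of
          Pos \<Rightarrow> S Pos Pos \<oplus>\<^sub>o S Neg Neg
        | Neg \<Rightarrow> S Pos Neg \<oplus>\<^sub>o S Neg Pos)"

definition S_rest ::
    "('a::chilbert_space \<Rightarrow> 'b::chilbert_space \<Rightarrow> 'c::chilbert_space) \<Rightarrow>
      'a operator \<Rightarrow> 'b operator \<Rightarrow> (sign \<Rightarrow> 'a \<Rightarrow> 'a) \<Rightarrow> (sign \<Rightarrow> 'b \<Rightarrow> 'b) \<Rightarrow>
      'c operator"
  where "S_rest tens T1 T2 P1 P2 =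
    (let S = S_part tens T1 T2 P1 P2
     in S Rest (Sgn Pos) \<oplus>\<^sub>o S Rest (Sgn Neg) \<oplus>\<^sub>o S Rest Rest
        \<oplus>\<^sub>o S (Sgn Pos) Rest \<oplus>\<^sub>o S (Sgn Neg) Rest)"

end

theory Submission
  imports Defs
begin

text \<open>The operators \<open>P\<^sub>1\<^sup>\<mu> \<otimes> P\<^sub>2\<^sup>\<nu>\<close> resolve the identity and map the graph of \<open>S\<close> into
  the graphs of the \<open>S\<^sup>\<mu>\<^sup>\<nu>\<close>. If \<open>z\<close> is in the resolvent set of a part of \<open>S\<close>, the corresponding
  component of every approximate eigensequence for \<open>z\<close> tends to zero, so that only the components
  on which \<open>J\<close> is uniformly definite survive in the limit. Existence of tensor products of bounded
  operators, definiteness of \<open>J\<^sub>1 \<otimes> J\<^sub>2\<close> on the tensor product of definite subspaces, and the bound on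
  the cross terms in (iii) are all instances of the Schur product theorem for positive semidefinite
  kernels, applied to finite sums of simple tensors.\<close>

section \<open>Complex inner product spaces\<close>

text \<open>A vector of the tensor product is in general no simple tensor, so inequalities in the
  factors do not extend to it by linearity. They extend because the form of a tensor product of
  operators A, B at a sum of simple tensors x_i, x'_i is the sum of all entries of the entrywise
  product of the kernels (A x_i, x_j) and (B x'_i, x'_j). Operator inequalities in the factors say
  that differences of such kernels are positive semidefinite. \<open>J\<close> need not be block
  diagonal for the nine parts. In (i) and (ii) a single block survives, so no interaction is left to
  control. In (iii) two blocks survive and interact through the cross terms of \<open>J1\<close>
  times those of \<open>J2\<close>. The smallness condition is positive definiteness of the 2x2
  matrix whose diagonal holds the lower bounds of the two blocks and whose off-diagonal entries are
  minus the product of the two cross constants; for both signs the diagonal has the same product.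
  The link between \<open>S\<close> and its parts enters through two inclusions that survive
  closure: the graphs of the parts lie in that of \<open>S\<close>, and the tensor products of
  projections carry the graph of \<open>S\<close> into those of the parts.\<close>

lemma cinner_add_right: "cinner x (y + z) = cinner x y + cinner x z"
  by (metis cinner_add_left cinner_commute complex_cnj_add)

lemma cinner_scaleC_right: "cinner x (c *\<^sub>C y) = cnj c * cinner x y"
  by (metis cinner_scaleC_left cinner_commute complex_cnj_mult)

lemma cinner_scaleR_left: "cinner (r *\<^sub>R x) y = complex_of_real r * cinner x y"
  by (metis cinner_scaleC_left scaleC_of_real)

lemma cinner_scaleR_right: "cinner x (r *\<^sub>R y) = complex_of_real r * cinner x y"
  by (metis cinner_scaleC_right scaleC_of_real complex_cnj_complex_of_real)

lemma cinner_zero_left [simp]: "cinner 0 y = 0"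
  using cinner_scaleR_left[of 0 0 y] by simp

lemma cinner_zero_right [simp]: "cinner x 0 = 0"
  using cinner_scaleR_right[of x 0 0] by simp

lemma cinner_minus_left: "cinner (- x) y = - cinner x y"
  using cinner_scaleR_left[of "-1" x y] by simp

lemma cinner_minus_right: "cinner x (- y) = - cinner x y"
  using cinner_scaleR_right[of x "-1" y] by simp

lemma cinner_diff_left: "cinner (x - y) z = cinner x z - cinner y z"
  using cinner_add_left[of x "- y" z] by (simp add: cinner_minus_left)

lemma cinner_diff_right: "cinner x (y - z) = cinner x y - cinner x z"
  using cinner_add_right[of x y "- z"] by (simp add: cinner_minus_right)

lemma cinner_sum_left: "cinner (\<Sum>i\<in>I. x i) y = (\<Sum>i\<in>I. cinner (x i) y)"
  by (induction I rule: infinite_finite_induct) (simp_all add: cinner_add_left)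

lemma cinner_sum_right: "cinner x (\<Sum>i\<in>I. y i) = (\<Sum>i\<in>I. cinner x (y i))"
  by (induction I rule: infinite_finite_induct) (simp_all add: cinner_add_right)

lemma cinner_linear_combination:
  "cinner (\<Sum>i\<in>I. c i *\<^sub>C x i) (\<Sum>j\<in>J. d j *\<^sub>C y j) =
    (\<Sum>i\<in>I. \<Sum>j\<in>J. c i * cnj (d j) * cinner (x i) (y j))"
  unfolding cinner_sum_left
  by (simp add: cinner_sum_right cinner_scaleC_left cinner_scaleC_right sum_distrib_left mult_ac)

lemma Re_cinner_self: "Re (cinner x x) = (norm x)\<^sup>2"
proof -
  have "0 \<le> sqrt (Re (cinner x x))"
    by (metis norm_eq_sqrt_cinner norm_ge_zero)
  then show ?thesis
    by (simp add: norm_eq_sqrt_cinner)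
qed

lemma cinner_self: "cinner x x = complex_of_real ((norm x)\<^sup>2)"
proof (rule complex_eqI)
  show "Im (cinner x x) = Im (complex_of_real ((norm x)\<^sup>2))"
    using arg_cong[OF cinner_commute[of x x], of Im] by simp
qed (simp add: Re_cinner_self)

lemma norm_scaleC: "norm (c *\<^sub>C x) = cmod c * norm (x :: 'a::complex_inner)"
proof -
  have "complex_of_real ((norm (c *\<^sub>C x))\<^sup>2) = (c * cnj c) * complex_of_real ((norm x)\<^sup>2)"
    by (simp only: cinner_self[symmetric] cinner_scaleC_left cinner_scaleC_right mult_ac)
  also have "\<dots> = complex_of_real ((cmod c * norm x)\<^sup>2)"
    by (simp add: complex_norm_square[symmetric] power_mult_distrib)
  finally have "(norm (c *\<^sub>C x))\<^sup>2 = (cmod c * norm x)\<^sup>2"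
    using of_real_eq_iff by blast
  then show ?thesis
    by (simp add: power2_eq_iff_nonneg)
qed

lemma cmod_cinner_le: "cmod (cinner x y) \<le> norm x * norm y"
proof (cases "y = 0")
  case False
  \<comment> \<open>\<open>a *\<^sub>C y\<close> is the orthogonal projection of \<open>x\<close>
    onto the line of \<open>y\<close>, and \<open>t\<close> is its squared norm.\<close>
  define a where "a = cinner x y / complex_of_real ((norm y)\<^sup>2)"
  define t where "t = (cmod (cinner x y))\<^sup>2 / (norm y)\<^sup>2"
  have prod: "cinner x y * cnj (cinner x y) = complex_of_real ((cmod (cinner x y))\<^sup>2)"
    by (rule complex_norm_square[symmetric])
  have 1: "cnj a * cinner x y = complex_of_real t" and 2: "a * cinner y x = complex_of_real t"
    using prod by (simp_all add: a_def t_def cinner_commute[of y x] mult.commute)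
  have "cinner (x - a *\<^sub>C y) (x - a *\<^sub>C y)
      = cinner x x - cnj a * cinner x y - a * cinner y x + cnj a * (a * cinner y y)"
    by (simp add: cinner_diff_left cinner_diff_right cinner_scaleC_left cinner_scaleC_right
        algebra_simps)
  also have "a * cinner y y = cinner x y"
    using False by (simp add: a_def cinner_self)
  finally have "cinner (x - a *\<^sub>C y) (x - a *\<^sub>C y) = complex_of_real ((norm x)\<^sup>2 - t)"
    unfolding 1 2 by (simp add: cinner_self)
  then have "0 \<le> (norm x)\<^sup>2 - t"
    by (metis Re_complex_of_real Re_cinner_self zero_le_power2)
  then have "(cmod (cinner x y))\<^sup>2 \<le> (norm x * norm y)\<^sup>2"
    using False by (simp add: t_def divide_simps power_mult_distrib)
  then show ?thesis
    by (rule power2_le_imp_le) simp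
qed simp

lemma bounded_bilinear_cinner: "bounded_bilinear cinner"
proof
  show "\<exists>K. \<forall>a b. norm (cinner a b) \<le> norm a * norm b * K"
    by (intro exI[of _ 1]) (simp add: cmod_cinner_le)
qed (simp_all add: cinner_add_left cinner_add_right cinner_scaleR_left cinner_scaleR_right
    scaleR_conv_of_real)

lemmas continuous_on_cinner [continuous_intros] =
  bounded_bilinear.continuous_on[OF bounded_bilinear_cinner]

lemma bounded_linear_scaleC: "bounded_linear (\<lambda>x :: 'a::complex_inner. c *\<^sub>C x)"
proof (rule bounded_linear_intro)
  fix r and x :: 'a
  show "c *\<^sub>C (r *\<^sub>R x) = r *\<^sub>R (c *\<^sub>C x)"
    by (simp add: scaleC_of_real[symmetric] scaleC_scaleC mult.commute)
  show "norm (c *\<^sub>C x) \<le> norm x * cmod c"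
    by (simp add: norm_scaleC mult.commute)
qed (simp add: scaleC_add_right)

section \<open>Closures of subspaces and bounded complex-linear maps\<close>

lemma closure_add_mem:
  fixes S :: "'a::real_normed_vector set"
  assumes "\<And>x y. x \<in> S \<Longrightarrow> y \<in> S \<Longrightarrow> x + y \<in> S" "x \<in> closure S" "y \<in> closure S"
  shows "x + y \<in> closure S"
proof -
  obtain u v where "\<And>n. u n \<in> S" "u \<longlonglongrightarrow> x" "\<And>n. v n \<in> S" "v \<longlonglongrightarrow> y"
    using assms(2,3) by (auto simp: closure_sequential)
  then show ?thesis
    using assms(1) unfolding closure_sequential
    by (intro exI[of _ "\<lambda>n. u n + v n"]) (auto intro: tendsto_add)
qed

text \<open>Meant for graphs. The product type carries a complex vector space structure but no
  complex inner product here, so continuity of scalar multiplication comes from the two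
  components.\<close>

lemma csubspace_closure_prod:
  fixes G :: "('a::complex_inner \<times> 'b::complex_inner) set"
  assumes "csubspace G"
  shows "csubspace (closure G)"
proof (rule complex_vector.subspaceI)
  show "0 \<in> closure G"
    using complex_vector.subspace_0[OF assms] closure_subset by blast
next
  fix x y assume "x \<in> closure G" "y \<in> closure G"
  then show "x + y \<in> closure G"
    using closure_add_mem complex_vector.subspace_add[OF assms] by blast
next
  fix c x assume x: "x \<in> closure G"
  have "continuous_on (closure G) (\<lambda>z. c *\<^sub>C z)"
    unfolding scaleC_prod_def
    by (intro continuous_on_Pair bounded_linear.continuous_on[OF bounded_linear_scaleC]
        continuous_intros)
  moreover have "(\<lambda>z. c *\<^sub>C z) ` G \<subseteq> closure G"
    using complex_vector.subspace_scale[OF assms] closure_subset by blast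
  ultimately show "c *\<^sub>C x \<in> closure G"
    using image_closure_subset[of G "\<lambda>z. c *\<^sub>C z" "closure G"] x by blast
qed

lemma bounded_clinearD:
  assumes "bounded_clinear A"
  shows "bounded_linear A" "A (x + y) = A x + A y" "A (x - y) = A x - A y" "A 0 = 0"
    "A (c *\<^sub>C x) = c *\<^sub>C A x" "A (sum h I) = (\<Sum>i\<in>I. A (h i))"
  using assms bounded_linear.linear[of A]
  by (auto simp: bounded_clinear_def linear_add linear_diff linear_0 linear_sum)

lemma bounded_clinear_ident: "bounded_clinear (\<lambda>x. x)"
  by (simp add: bounded_clinear_def bounded_linear_ident)

lemma bounded_clinear_add:
  "bounded_clinear A \<Longrightarrow> bounded_clinear B \<Longrightarrow> bounded_clinear (\<lambda>x. A x + B x)"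
  by (simp add: bounded_clinear_def bounded_linear_add scaleC_add_right)

lemma bounded_clinear_diff:
  "bounded_clinear A \<Longrightarrow> bounded_clinear B \<Longrightarrow> bounded_clinear (\<lambda>x. A x - B x)"
  by (simp add: bounded_clinear_def bounded_linear_sub complex_vector.scale_right_diff_distrib)

lemma bounded_clinear_scaleR: "bounded_clinear A \<Longrightarrow> bounded_clinear (\<lambda>x. r *\<^sub>R A x)"
  unfolding scaleC_of_real[symmetric] bounded_clinear_def
  using bounded_linear_compose[OF bounded_linear_scaleC]
  by (auto simp: scaleC_scaleC mult.commute)

lemma csubspace_range:
  assumes "bounded_clinear A"
  shows "csubspace (range A)"
proof (rule complex_vector.subspaceI)
  show "0 \<in> range A"
    using bounded_clinearD(4)[OF assms] rangeI[of A 0] by simp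
next
  fix x y assume "x \<in> range A" "y \<in> range A"
  then obtain u v where "x = A u" "y = A v"
    by blast
  then show "x + y \<in> range A"
    using bounded_clinearD(2)[OF assms, of u v] rangeI[of A "u + v"] by simp
next
  fix c x assume "x \<in> range A"
  then obtain u where "x = A u"
    by blast
  then show "c *\<^sub>C x \<in> range A"
    using bounded_clinearD(5)[OF assms, of c u] rangeI[of A "c *\<^sub>C u"] by simp
qed


section \<open>Positive semidefinite kernels\<close>

text \<open>The Hermitian condition stands on its own because nonnegativity of the real part
  constrains only the Hermitian part of \<open>K\<close>. The notion is meant for finite
  \<open>I\<close>; over an infinite set the sum is 0 by convention.\<close>

definition psd :: "'i set \<Rightarrow> ('i \<Rightarrow> 'i \<Rightarrow> complex) \<Rightarrow> bool"
  where "psd I K \<longleftrightarrow> (\<forall>i\<in>I. \<forall>j\<in>I. K j i = cnj (K i j)) \<and>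
    (\<forall>c. 0 \<le> Re (\<Sum>i\<in>I. \<Sum>j\<in>I. c i * cnj (c j) * K i j))"

lemma psd_hermitian: "psd I K \<Longrightarrow> i \<in> I \<Longrightarrow> j \<in> I \<Longrightarrow> K j i = cnj (K i j)"
  unfolding psd_def by blast

lemma psd_nonneg: "psd I K \<Longrightarrow> 0 \<le> Re (\<Sum>i\<in>I. \<Sum>j\<in>I. c i * cnj (c j) * K i j)"
  unfolding psd_def by blast

lemma psd_subset:
  assumes "psd I K" "J \<subseteq> I" "finite I"
  shows "psd J K"
  unfolding psd_def
proof (intro conjI allI)
  show "\<forall>i\<in>J. \<forall>j\<in>J. K j i = cnj (K i j)"
    using assms(2) psd_hermitian[OF assms(1)] by (meson subsetD)
  fix c :: "'a \<Rightarrow> complex"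
  define d where "d i = (if i \<in> J then c i else 0)" for i
  have "(\<Sum>i\<in>J. \<Sum>j\<in>J. c i * cnj (c j) * K i j) = (\<Sum>i\<in>J. \<Sum>j\<in>J. d i * cnj (d j) * K i j)"
    by (simp add: d_def)
  also have "\<dots> = (\<Sum>i\<in>I. \<Sum>j\<in>J. d i * cnj (d j) * K i j)"
    using assms by (intro sum.mono_neutral_left) (auto simp: d_def)
  also have "\<dots> = (\<Sum>i\<in>I. \<Sum>j\<in>I. d i * cnj (d j) * K i j)"
    using assms by (intro sum.cong refl sum.mono_neutral_left) (auto simp: d_def)
  finally show "0 \<le> Re (\<Sum>i\<in>J. \<Sum>j\<in>J. c i * cnj (c j) * K i j)"
    using psd_nonneg[OF assms(1), of d] by simp
qed

lemma psd_diagonal: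
  assumes "psd I K" "finite I" "p \<in> I"
  shows "K p p = complex_of_real (Re (K p p))" "0 \<le> Re (K p p)"
proof -
  show "K p p = complex_of_real (Re (K p p))"
    using arg_cong[OF psd_hermitian[OF assms(1,3,3)], of Im] by (simp add: complex_eq_iff)
  show "0 \<le> Re (K p p)"
    using psd_nonneg[OF psd_subset[OF assms(1), of "{p}"], of "\<lambda>_. 1"] assms by simp
qed

text \<open>On the two indices \<open>i\<close>, \<open>p\<close> the form is affine in the multiple
  \<open>t\<close> of the coefficient at \<open>p\<close>, since its quadratic term carries the
  factor \<open>K p p = 0\<close>. A nonzero entry \<open>K i p\<close> would make it unbounded
  below.\<close>

lemma psd_zero_diagonal:
  assumes "psd I K" "finite I" "p \<in> I" "i \<in> I" "K p p = 0"
  shows "K i p = 0"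
proof (rule ccontr)
  assume nz: "K i p \<noteq> 0"
  then have ne: "i \<noteq> p"
    using assms(5) by auto
  define z where "z = K i p"
  have pi: "K p i = cnj z"
    using psd_hermitian[OF assms(1,4,3)] by (simp add: z_def)
  define s where "s = (cmod z)\<^sup>2"
  have zz: "z * cnj z = complex_of_real s"
    unfolding s_def by (rule complex_norm_square[symmetric])
  have s: "s > 0"
    using nz by (simp add: s_def z_def)
  \<comment> \<open>Solves \<open>Re (K i i) - 2 * t * s = -1\<close>, so that the form takes a
    negative value.\<close>
  define t where "t = (Re (K i i) + 1) / (2 * s)"
  define c where "c = (\<lambda>j. if j = i then 1 else - complex_of_real t * z)"
  have "(\<Sum>j\<in>{i,p}. \<Sum>k\<in>{i,p}. c j * cnj (c k) * K j k)
      = K i i - complex_of_real t * (z * cnj z) - complex_of_real t * (z * cnj z)"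
    using ne assms(5) pi by (simp add: c_def z_def[symmetric] algebra_simps)
  then have "0 \<le> Re (K i i - complex_of_real t * (z * cnj z) - complex_of_real t * (z * cnj z))"
    using psd_nonneg[OF psd_subset[OF assms(1), of "{i,p}"], of c] assms by simp
  also have "\<dots> = Re (K i i) - 2 * t * s"
    unfolding zz by simp
  also have "\<dots> = -1"
    using s by (simp add: t_def field_simps)
  finally show False
    by simp
qed

text \<open>Completing the square: if the coefficient at \<open>p\<close> is moved to the minimiser
  of the form, the value of the form is that of the complement at the original coefficients.\<close>

lemma psd_schur_complement:
  assumes "psd I K" "finite I" "p \<in> I" "K p p \<noteq> 0"
  shows "psd I (\<lambda>i j. K i j - K i p * cnj (K j p) / K p p)"
  unfolding psd_def
proof (intro conjI ballI allI)
  note real = psd_diagonal(1)[OF assms(1-3)]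
  have cnj_k: "cnj (K p p) = K p p"
    using psd_hermitian[OF assms(1,3,3)] by simp
  fix i j assume "i \<in> I" "j \<in> I"
  then show "K j i - K j p * cnj (K i p) / K p p = cnj (K i j - K i p * cnj (K j p) / K p p)"
    using psd_hermitian[OF assms(1), of i j] by (simp add: cnj_k mult.commute)
next
  fix c :: "'a \<Rightarrow> complex"
  define k where "k = K p p"
  have cnj_k: "cnj k = k" and k: "k \<noteq> 0"
    using psd_hermitian[OF assms(1,3,3)] assms(4) by (simp_all add: k_def)
  define w where "w = (\<Sum>i\<in>I. c i * K i p)"
  \<comment> \<open>The shift by \<open>w / k\<close> is the minimiser in the coordinate
    \<open>p\<close>.\<close>
  define d where "d = (\<lambda>i. c i - (if i = p then w / k else 0))"
  have delta: "(\<Sum>i\<in>I. (e i - (if i = p then u else 0)) * X i) = (\<Sum>i\<in>I. e i * X i) - u * X p"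
    for e X :: "'a \<Rightarrow> complex" and u
  proof -
    have "(\<Sum>i\<in>I. (e i - (if i = p then u else 0)) * X i)
        = (\<Sum>i\<in>I. e i * X i - (if i = p then u * X i else 0))"
      by (intro sum.cong) (auto simp: algebra_simps)
    then show ?thesis
      using assms(2,3) by (simp add: sum_subtractf)
  qed
  have row: "(\<Sum>j\<in>I. cnj (d j) * K i j) = (\<Sum>j\<in>I. cnj (c j) * K i j) - cnj w / k * K i p" for i
  proof -
    have "cnj (d j) = cnj (c j) - (if j = p then cnj w / k else 0)" for j
      by (simp add: d_def cnj_k)
    then show ?thesis
      by (simp add: delta)
  qed
  have cnj_w: "cnj w = (\<Sum>j\<in>I. cnj (c j) * K p j)"
    unfolding w_def using psd_hermitian[OF assms(1) _ assms(3)] by simp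
  have "(\<Sum>i\<in>I. \<Sum>j\<in>I. d i * cnj (d j) * K i j) = (\<Sum>i\<in>I. d i * (\<Sum>j\<in>I. cnj (d j) * K i j))"
    by (simp add: sum_distrib_left mult.assoc)
  also have "\<dots> = (\<Sum>i\<in>I. c i * (\<Sum>j\<in>I. cnj (d j) * K i j)) - w / k * (\<Sum>j\<in>I. cnj (d j) * K p j)"
    unfolding d_def by (rule delta)
  \<comment> \<open>Stationarity at the minimiser: the row of \<open>p\<close> annihilates
    \<open>d\<close>, so the correction term of the double sum drops out.\<close>
  also have "(\<Sum>j\<in>I. cnj (d j) * K p j) = 0"
    unfolding row cnj_w[symmetric] using k by (simp add: k_def)
  also have "(\<Sum>i\<in>I. c i * (\<Sum>j\<in>I. cnj (d j) * K i j))
      = (\<Sum>i\<in>I. \<Sum>j\<in>I. c i * cnj (c j) * K i j) - w * cnj w / k"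
  proof -
    have "(\<Sum>i\<in>I. c i * (cnj w / k * K i p)) = w * cnj w / k"
      unfolding w_def sum_distrib_right sum_divide_distrib by (simp add: mult_ac)
    then show ?thesis
      unfolding row by (simp add: right_diff_distrib sum_subtractf sum_distrib_left mult.assoc)
  qed
  also have "w * cnj w / k = (\<Sum>i\<in>I. \<Sum>j\<in>I. c i * cnj (c j) * (K i p * cnj (K j p) / k))"
    unfolding w_def by (simp add: sum_product sum_divide_distrib mult_ac)
  finally have "(\<Sum>i\<in>I. \<Sum>j\<in>I. d i * cnj (d j) * K i j)
      = (\<Sum>i\<in>I. \<Sum>j\<in>I. c i * cnj (c j) * (K i j - K i p * cnj (K j p) / K p p))"
    by (simp add: right_diff_distrib sum_subtractf k_def)
  then show "0 \<le> Re (\<Sum>i\<in>I. \<Sum>j\<in>I. c i * cnj (c j) * (K i j - K i p * cnj (K j p) / K p p))"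
    using psd_nonneg[OF assms(1), of d] by simp
qed

text \<open>Splitting off the rank one part of \<open>K\<close> belonging to an index
  \<open>p\<close> leaves a kernel that vanishes on the row and column of \<open>p\<close>.\<close>

lemma psd_schur_product:
  assumes "finite I" "psd I K" "psd I L"
  shows "0 \<le> Re (\<Sum>i\<in>I. \<Sum>j\<in>I. K i j * L i j)"
  using assms
proof (induction I arbitrary: K rule: finite_induct)
  case (insert p F)
  let ?I = "insert p F"
  define k where "k = Re (K p p)"
  have fin: "finite ?I"
    using insert.hyps by simp
  have k: "K p p = complex_of_real k" "0 \<le> k"
    using psd_diagonal[OF insert.prems(1) fin] by (simp_all add: k_def)
  have vanish: "K i p = 0" if "K p p = 0" "i \<in> ?I" for i
    using psd_zero_diagonal[OF insert.prems(1) fin _ that(2,1)] by simp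
  \<comment> \<open>For \<open>K p p = 0\<close> the quotient is 0 by convention and
    \<open>K'\<close> is \<open>K\<close>; the row and column of \<open>p\<close> then vanish by
    \<open>vanish\<close>, so one formula serves both cases.\<close>
  define K' where "K' = (\<lambda>i j. K i j - K i p * cnj (K j p) / K p p)"
  have K': "psd ?I K'"
  proof (cases "K p p = 0")
    case False
    then show ?thesis
      unfolding K'_def using psd_schur_complement[OF insert.prems(1) fin] by simp
  qed (use insert.prems(1) in \<open>simp add: K'_def\<close>)
  have psd_F: "psd F K'" "psd F L"
    using psd_subset[OF _ _ fin] K' insert.prems(2) by auto
  have zero: "K' i p = 0 \<and> K' p i = 0" if "i \<in> ?I" for i
    using vanish[OF _ that] vanish[of p] psd_hermitian[OF insert.prems(1) that, of p]
    by (auto simp: K'_def k)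
  have "(\<Sum>i\<in>?I. \<Sum>j\<in>?I. K' i j * L i j) = (\<Sum>i\<in>F. \<Sum>j\<in>F. K' i j * L i j)"
    using insert.hyps zero by simp
  moreover have "0 \<le> Re (\<Sum>i\<in>F. \<Sum>j\<in>F. K' i j * L i j)"
    by (rule insert.IH[OF psd_F])
  \<comment> \<open>The rank one part contributes the form of \<open>L\<close> at the coefficients
    \<open>K i p\<close>, divided by \<open>k\<close>; for \<open>k = 0\<close> the contribution is
    0 by the convention on division.\<close>
  moreover have "0 \<le> Re (\<Sum>i\<in>?I. \<Sum>j\<in>?I. K i p * cnj (K j p) / K p p * L i j)"
  proof -
    have "(\<Sum>i\<in>?I. \<Sum>j\<in>?I. K i p * cnj (K j p) / K p p * L i j)
        = complex_of_real (1 / k) * (\<Sum>i\<in>?I. \<Sum>j\<in>?I. K i p * cnj (K j p) * L i j)"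
      unfolding k(1) sum_distrib_left by (intro sum.cong refl) simp
    then have "Re (\<Sum>i\<in>?I. \<Sum>j\<in>?I. K i p * cnj (K j p) / K p p * L i j)
        = (1 / k) * Re (\<Sum>i\<in>?I. \<Sum>j\<in>?I. K i p * cnj (K j p) * L i j)"
      by (simp only: Re_complex_of_real Im_complex_of_real times_complex.sel mult_zero_left diff_zero)
    then show ?thesis
      using mult_nonneg_nonneg[OF _ psd_nonneg[OF insert.prems(2), of "\<lambda>i. K i p"], of "1 / k"] k(2)
      by (simp only: zero_le_divide_1_iff)
  qed
  moreover have "(\<Sum>i\<in>?I. \<Sum>j\<in>?I. K i j * L i j)
      = (\<Sum>i\<in>?I. \<Sum>j\<in>?I. K i p * cnj (K j p) / K p p * L i j) + (\<Sum>i\<in>?I. \<Sum>j\<in>?I. K' i j * L i j)"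
    unfolding sum.distrib[symmetric] by (intro sum.cong refl) (simp add: K'_def algebra_simps)
  ultimately show ?case
    by simp
qed simp

text \<open>Writing \<open>X = P + (X - P)\<close> and \<open>Y = Q + (Y - Q)\<close>, the entrywise
  product exceeds that of \<open>P\<close> and \<open>Q\<close> by three products of positive
  semidefinite kernels. Through this lemma bounds on the factors become bounds on tensors.\<close>

lemma psd_schur_product_mono:
  assumes "finite I" "psd I P" "psd I (\<lambda>i j. X i j - P i j)" "psd I Q" "psd I (\<lambda>i j. Y i j - Q i j)"
  shows "Re (\<Sum>i\<in>I. \<Sum>j\<in>I. P i j * Q i j) \<le> Re (\<Sum>i\<in>I. \<Sum>j\<in>I. X i j * Y i j)"
proof -
  have "(\<Sum>i\<in>I. \<Sum>j\<in>I. X i j * Y i j) = (\<Sum>i\<in>I. \<Sum>j\<in>I. P i j * Q i j)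
      + ((\<Sum>i\<in>I. \<Sum>j\<in>I. (X i j - P i j) * (Y i j - Q i j))
      + (\<Sum>i\<in>I. \<Sum>j\<in>I. (X i j - P i j) * Q i j) + (\<Sum>i\<in>I. \<Sum>j\<in>I. P i j * (Y i j - Q i j)))"
    unfolding sum.distrib[symmetric] by (intro sum.cong refl) (simp add: algebra_simps)
  then show ?thesis
    using psd_schur_product[OF assms(1,3,5)] psd_schur_product[OF assms(1,3,4)]
      psd_schur_product[OF assms(1,2,5)] by simp
qed

section \<open>Kernels obtained from vectors and operators\<close>

lemma psd_gram: "psd I (\<lambda>i j. cinner (x i) (x j))"
  unfolding psd_def cinner_linear_combination[symmetric] Re_cinner_self
  by (intro conjI ballI allI zero_le_power2) (rule cinner_commute)

lemma psd_scale:
  assumes "psd I K" "0 \<le> r"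
  shows "psd I (\<lambda>i j. complex_of_real r * K i j)"
  unfolding psd_def
proof (intro conjI allI)
  show "\<forall>i\<in>I. \<forall>j\<in>I. complex_of_real r * K j i = cnj (complex_of_real r * K i j)"
    using psd_hermitian[OF assms(1)] by (metis complex_cnj_complex_of_real complex_cnj_mult)
  fix c :: "'a \<Rightarrow> complex"
  have "(\<Sum>i\<in>I. \<Sum>j\<in>I. c i * cnj (c j) * (complex_of_real r * K i j))
      = complex_of_real r * (\<Sum>i\<in>I. \<Sum>j\<in>I. c i * cnj (c j) * K i j)"
    by (simp add: sum_distrib_left mult_ac)
  then show "0 \<le> Re (\<Sum>i\<in>I. \<Sum>j\<in>I. c i * cnj (c j) * (complex_of_real r * K i j))"
    using psd_nonneg[OF assms(1), of c] assms(2) by simp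
qed

lemma bounded_clinear_linear_combination:
  "bounded_clinear A \<Longrightarrow> A (\<Sum>i\<in>I. c i *\<^sub>C x i) = (\<Sum>i\<in>I. c i *\<^sub>C A (x i))"
  by (simp add: bounded_clinearD)

text \<open>The kernel form of A^* A \<le> M^2: its value at \<open>c\<close> is the defect of the
  norm bound at the linear combination \<open>u\<close> of the \<open>x i\<close>.\<close>

lemma psd_gram_bounded:
  fixes x :: "'i \<Rightarrow> 'a::complex_inner"
  assumes A: "bounded_clinear A" and bound: "\<And>u. norm (A u) \<le> M * norm u"
  shows "psd I (\<lambda>i j. complex_of_real (M\<^sup>2) * cinner (x i) (x j) - cinner (A (x i)) (A (x j)))"
  unfolding psd_def
proof (intro conjI allI ballI)
  fix i j
  show "complex_of_real (M\<^sup>2) * cinner (x j) (x i) - cinner (A (x j)) (A (x i))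
      = cnj (complex_of_real (M\<^sup>2) * cinner (x i) (x j) - cinner (A (x i)) (A (x j)))"
    by (simp add: cinner_commute[of "x j"] cinner_commute[of "A (x j)"])
next
  fix c :: "'i \<Rightarrow> complex"
  define u where "u = (\<Sum>i\<in>I. c i *\<^sub>C x i)"
  have Au: "A u = (\<Sum>i\<in>I. c i *\<^sub>C A (x i))"
    unfolding u_def by (rule bounded_clinear_linear_combination[OF A])
  have "(\<Sum>i\<in>I. \<Sum>j\<in>I. c i * cnj (c j) *
        (complex_of_real (M\<^sup>2) * cinner (x i) (x j) - cinner (A (x i)) (A (x j))))
      = complex_of_real (M\<^sup>2) * cinner u u - cinner (A u) (A u)"
    unfolding Au unfolding u_def cinner_linear_combination
    by (simp add: right_diff_distrib sum_subtractf sum_distrib_left mult.left_commute)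
  moreover have "(norm (A u))\<^sup>2 \<le> (M * norm u)\<^sup>2"
    using bound[of u] by (intro power_mono) auto
  then have "0 \<le> Re (complex_of_real (M\<^sup>2) * cinner u u - cinner (A u) (A u))"
    by (simp add: cinner_self power_mult_distrib)
  ultimately show "0 \<le> Re (\<Sum>i\<in>I. \<Sum>j\<in>I. c i * cnj (c j) *
        (complex_of_real (M\<^sup>2) * cinner (x i) (x j) - cinner (A (x i)) (A (x j))))"
    by (simp only:)
qed

text \<open>The bound is tested at linear combinations of the \<open>x i\<close>, which is why it is
  stated on a subspace \<open>M\<close> and not just at these vectors.\<close>

lemma psd_lower_bound:
  fixes x :: "'i \<Rightarrow> 'a::complex_inner"
  assumes A: "bounded_clinear A" and herm: "\<And>f g. cinner (A f) g = cinner f (A g)"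
    and M: "csubspace M" "\<And>i. i \<in> I \<Longrightarrow> x i \<in> M"
    and bound: "\<And>u. u \<in> M \<Longrightarrow> \<kappa> * (norm u)\<^sup>2 \<le> Re (cinner (A u) u)"
  shows "psd I (\<lambda>i j. cinner (A (x i)) (x j) - complex_of_real \<kappa> * cinner (x i) (x j))"
  unfolding psd_def
proof (intro conjI allI ballI)
  fix i j
  show "cinner (A (x j)) (x i) - complex_of_real \<kappa> * cinner (x j) (x i)
      = cnj (cinner (A (x i)) (x j) - complex_of_real \<kappa> * cinner (x i) (x j))"
    by (simp add: cinner_commute[of "x j"] herm)
next
  fix c :: "'i \<Rightarrow> complex"
  define u where "u = (\<Sum>i\<in>I. c i *\<^sub>C x i)"
  have Au: "A u = (\<Sum>i\<in>I. c i *\<^sub>C A (x i))"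
    unfolding u_def by (rule bounded_clinear_linear_combination[OF A])
  have "u \<in> M"
    unfolding u_def using M
    by (intro complex_vector.subspace_sum complex_vector.subspace_scale) auto
  then have "0 \<le> Re (cinner (A u) u - complex_of_real \<kappa> * cinner u u)"
    using bound[of u] by (simp add: cinner_self)
  also have "cinner (A u) u - complex_of_real \<kappa> * cinner u u = (\<Sum>i\<in>I. \<Sum>j\<in>I. c i * cnj (c j) *
        (cinner (A (x i)) (x j) - complex_of_real \<kappa> * cinner (x i) (x j)))"
    unfolding Au unfolding u_def cinner_linear_combination
    by (simp add: right_diff_distrib sum_subtractf sum_distrib_left mult.left_commute)
  finally show "0 \<le> Re (\<Sum>i\<in>I. \<Sum>j\<in>I. c i * cnj (c j) *
        (cinner (A (x i)) (x j) - complex_of_real \<kappa> * cinner (x i) (x j)))" .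
qed

lemma sum_times_bool:
  "finite I \<Longrightarrow> (\<Sum>p\<in>I \<times> (UNIV :: bool set). F p) = (\<Sum>i\<in>I. F (i, True)) + (\<Sum>i\<in>I. F (i, False))"
  by (simp add: sum.cartesian_product[symmetric, where g = "\<lambda>i b. F (i, b)", simplified]
      UNIV_bool sum.distrib add.commute)

text \<open>In the product of two such kernels only tensors of equally tagged vectors and the cross terms
  between the two tags occur. The weight \<open>t\<close> keeps the constant \<open>k\<close> in the cross terms sharp.\<close>

lemma psd_twisted_gram:
  fixes x :: "'i \<times> bool \<Rightarrow> 'a::complex_inner"
  assumes fin: "finite I"
    and A: "bounded_clinear A" and herm: "\<And>f g. cinner (A f) g = cinner f (A g)"
    and M: "csubspace M" "\<And>i. i \<in> I \<Longrightarrow> x (i, True) \<in> M"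
    and N: "csubspace N" "\<And>i. i \<in> I \<Longrightarrow> x (i, False) \<in> N"
    and bound: "\<And>u v. u \<in> M \<Longrightarrow> v \<in> N \<Longrightarrow> cmod (cinner (A u) v) \<le> k * norm u * norm v"
    and k: "0 \<le> k" and t: "0 < t"
  shows "psd (I \<times> UNIV) (\<lambda>p q. if snd p = snd q
      then complex_of_real (if snd p then k * t else k / t) * cinner (x p) (x q)
      else cinner (A (x p)) (x q))" (is "psd _ ?K")
  unfolding psd_def
proof (intro conjI allI ballI)
  fix p q :: "'i \<times> bool"
  show "?K q p = cnj (?K p q)"
    using cinner_commute[of "x q" "x p"] cinner_commute[of "A (x q)" "x p"]
    by (auto simp: herm)
next
  fix c :: "'i \<times> bool \<Rightarrow> complex"
  define u where "u b = (\<Sum>i\<in>I. c (i, b) *\<^sub>C x (i, b))" for b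
  have Au: "A (u b) = (\<Sum>i\<in>I. c (i, b) *\<^sub>C A (x (i, b)))" for b
    unfolding u_def by (rule bounded_clinear_linear_combination[OF A])
  have u: "u True \<in> M" "u False \<in> N"
    unfolding u_def using M N
    by (auto intro!: complex_vector.subspace_sum complex_vector.subspace_scale)
  have "(\<Sum>p\<in>I \<times> UNIV. \<Sum>q\<in>I \<times> UNIV. c p * cnj (c q) * ?K p q)
      = complex_of_real (k * t) * cinner (u True) (u True) + cinner (A (u True)) (u False)
        + (cinner (A (u False)) (u True) + complex_of_real (k / t) * cinner (u False) (u False))"
    unfolding Au unfolding u_def cinner_linear_combination sum_times_bool[OF fin]
    by (simp add: sum.distrib sum_distrib_left mult.left_commute)
  then have "Re (\<Sum>p\<in>I \<times> UNIV. \<Sum>q\<in>I \<times> UNIV. c p * cnj (c q) * ?K p q)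
      = k * t * (norm (u True))\<^sup>2 + Re (cinner (A (u True)) (u False))
        + (Re (cinner (A (u False)) (u True)) + k / t * (norm (u False))\<^sup>2)"
    by (simp add: cinner_self del: of_real_mult of_real_divide)
  moreover have "Re (cinner (A (u False)) (u True)) = Re (cinner (A (u True)) (u False))"
    using arg_cong[OF cinner_commute[of "A (u False)" "u True"], of Re] by (simp add: herm)
  moreover have "- (k * norm (u True) * norm (u False)) \<le> Re (cinner (A (u True)) (u False))"
    using bound[OF u] abs_Re_le_cmod[of "cinner (A (u True)) (u False)"] by linarith
  \<comment> \<open>Weighted arithmetic-geometric mean inequality: the two diagonal terms absorb
    twice the cross term for every positive \<open>t\<close>.\<close>
  moreover have "k * t * (norm (u True))\<^sup>2 + k / t * (norm (u False))\<^sup>2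
      - 2 * (k * norm (u True) * norm (u False)) = k / t * (t * norm (u True) - norm (u False))\<^sup>2"
    using t by (simp add: power2_eq_square field_simps)
  moreover have "0 \<le> k / t * (t * norm (u True) - norm (u False))\<^sup>2"
    using k t by simp
  ultimately show "0 \<le> Re (\<Sum>p\<in>I \<times> UNIV. \<Sum>q\<in>I \<times> UNIV. c p * cnj (c q) * ?K p q)"
    by linarith
qed


section \<open>Hilbert space tensor products\<close>

lemma cspan_explicitE:
  assumes "h \<in> cspan S"
  obtains I r where "finite I" "I \<subseteq> S" "h = (\<Sum>i\<in>I. r i *\<^sub>C i)"
  using assms unfolding complex_vector.span_explicit
  by (elim CollectE exE conjE) (rule that)

locale hilbert_tensor =
  fixes tens :: "'a::chilbert_space \<Rightarrow> 'b::chilbert_space \<Rightarrow> 'c::chilbert_space"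
  assumes tensor: "hilbert_tensor_product tens"
begin

lemma tens_add_left: "tens (f + f') g = tens f g + tens f' g"
  and tens_add_right: "tens f (g + g') = tens f g + tens f g'"
  and tens_scaleC_left: "tens (c *\<^sub>C f) g = c *\<^sub>C tens f g"
  and tens_scaleC_right: "tens f (c *\<^sub>C g) = c *\<^sub>C tens f g"
  and cinner_tens: "cinner (tens f g) (tens f' g') = cinner f f' * cinner g g'"
  and dense_tens: "closure (cspan {tens f g | f g. True}) = UNIV"
  using tensor unfolding hilbert_tensor_product_def by blast+

lemma tens_scaleR_left: "tens (r *\<^sub>R f) g = r *\<^sub>R tens f g"
  using tens_scaleC_left[of "complex_of_real r"] by (simp add: scaleC_of_real)

lemma cinner_tens_sum:
  "cinner (\<Sum>i\<in>I. tens (x i) (x' i)) (\<Sum>j\<in>J. tens (y j) (y' j)) =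
    (\<Sum>i\<in>I. \<Sum>j\<in>J. cinner (x i) (y j) * cinner (x' i) (y' j))"
  by (simp add: cinner_sum_left cinner_sum_right cinner_tens) (rule sum.swap)

text \<open>Scalars are absorbed into the left factors. The index type is \<open>'c\<close> because
  the explicit description of a span indexes a combination by its own vectors.\<close>

lemma cspan_tensE:
  assumes "h \<in> cspan {tens f g | f g. True}"
  obtains I :: "'c set" and x x' where "finite I" "h = (\<Sum>i\<in>I. tens (x i) (x' i))"
proof -
  obtain I r where I: "finite I" "I \<subseteq> {tens f g | f g. True}" "h = (\<Sum>i\<in>I. r i *\<^sub>C i)"
    using cspan_explicitE[OF assms] .
  then have "\<forall>i\<in>I. \<exists>fg. i = tens (fst fg) (snd fg)"
    by auto
  then obtain \<phi> where "\<forall>i\<in>I. i = tens (fst (\<phi> i)) (snd (\<phi> i))"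
    by metis
  then have "h = (\<Sum>i\<in>I. tens (r i *\<^sub>C fst (\<phi> i)) (snd (\<phi> i)))"
    unfolding I(3) by (intro sum.cong refl) (simp add: tens_scaleC_left)
  with I(1) show thesis
    by (rule that)
qed

text \<open>The passage to the completion: each later estimate is a closed condition on
  \<open>h\<close>, so finite sums of simple tensors suffice.\<close>

lemma dense_induct:
  assumes "closed {h. Q h}"
    and "\<And>(I :: 'c set) x x'. finite I \<Longrightarrow> Q (\<Sum>i\<in>I. tens (x i) (x' i))"
  shows "Q h"
proof -
  have "Q h" if "h \<in> cspan {tens f g | f g. True}" for h
    using that by (rule cspan_tensE) (simp add: assms(2))
  then have "cspan {tens f g | f g. True} \<subseteq> {h. Q h}"
    by (intro subsetI CollectI)
  then have "closure (cspan {tens f g | f g. True}) \<subseteq> {h. Q h}"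
    by (rule closure_minimal[OF _ assms(1)])
  then show ?thesis
    unfolding dense_tens by blast
qed

text \<open>Both squared norms are sums of entrywise products of Gram kernels, and the kernels of
  the images are dominated by \<open>M\<^sup>2\<close> and \<open>N\<^sup>2\<close> times the
  original ones. The bound holds for every representation as a sum, hence also yields
  well-definedness of the tensor product of \<open>A\<close> and \<open>B\<close>.\<close>

lemma norm_sum_tens_le:
  assumes "finite I" "bounded_clinear A" "bounded_clinear B"
    and A: "\<And>f. norm (A f) \<le> M * norm f" and B: "\<And>g. norm (B g) \<le> N * norm g"
    and nonneg: "0 \<le> M" "0 \<le> N"
  shows "norm (\<Sum>i\<in>I. tens (A (x i)) (B (x' i))) \<le> M * N * norm (\<Sum>i\<in>I. tens (x i) (x' i))"
    (is "norm ?k \<le> _ * norm ?h")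
proof -
  have "Re (\<Sum>i\<in>I. \<Sum>j\<in>I. cinner (A (x i)) (A (x j)) * cinner (B (x' i)) (B (x' j)))
      \<le> Re (\<Sum>i\<in>I. \<Sum>j\<in>I. (complex_of_real (M\<^sup>2) * cinner (x i) (x j))
          * (complex_of_real (N\<^sup>2) * cinner (x' i) (x' j)))"
    by (rule psd_schur_product_mono[OF assms(1) psd_gram psd_gram_bounded[OF assms(2) A]
          psd_gram psd_gram_bounded[OF assms(3) B]])
  also have "(\<Sum>i\<in>I. \<Sum>j\<in>I. (complex_of_real (M\<^sup>2) * cinner (x i) (x j))
          * (complex_of_real (N\<^sup>2) * cinner (x' i) (x' j)))
      = complex_of_real ((M * N)\<^sup>2) * cinner ?h ?h"
    unfolding cinner_tens_sum sum_distrib_left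
    by (intro sum.cong refl) (simp add: power_mult_distrib)
  also have "(\<Sum>i\<in>I. \<Sum>j\<in>I. cinner (A (x i)) (A (x j)) * cinner (B (x' i)) (B (x' j)))
      = cinner ?k ?k"
    by (rule cinner_tens_sum[symmetric])
  finally have "(norm ?k)\<^sup>2 \<le> (M * N * norm ?h)\<^sup>2"
    by (simp add: cinner_self power_mult_distrib del: of_real_power of_real_mult
        flip: of_real_mult)
  then show ?thesis
    by (rule power2_le_imp_le) (simp add: nonneg)
qed

text \<open>The extension is constructed through its graph, the closure of the algebraic one.\<close>

lemma tensor_bounded_exists:
  assumes A: "bounded_clinear A" and B: "bounded_clinear B"
  shows "\<exists>C :: 'c \<Rightarrow> 'c. bounded_clinear C \<and> (\<forall>f g. C (tens f g) = tens (A f) (B g))"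
proof -
  obtain M N where MN: "0 \<le> M" "\<And>f. norm (A f) \<le> M * norm f"
      "0 \<le> N" "\<And>g. norm (B g) \<le> N * norm g"
    using bounded_linear.nonneg_bounded[OF bounded_clinearD(1)[OF A]]
      bounded_linear.nonneg_bounded[OF bounded_clinearD(1)[OF B]]
    by (metis mult.commute)
  define R0 where "R0 = cspan {(tens f g, tens (A f) (B g)) | f g. True}"
  define R where "R = closure R0"
  have sub: "csubspace R"
    unfolding R_def R0_def using complex_vector.subspace_span
    by (intro csubspace_closure_prod)
  have R0_tens: "(tens f g, tens (A f) (B g)) \<in> R0" for f g
    unfolding R0_def by (rule complex_vector.span_base) blast
  have R0_sub: "csubspace R0"
    unfolding R0_def by (rule complex_vector.subspace_span)
  have R0_sum: "(\<Sum>i\<in>I. tens (x i) (x' i), \<Sum>i\<in>I. tens (A (x i)) (B (x' i))) \<in> R0"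
    for I :: "'c set" and x x'
    using complex_vector.subspace_sum[OF R0_sub, of I "\<lambda>i. (tens (x i) (x' i), tens (A (x i)) (B (x' i)))"]
      R0_tens by (simp add: sum_prod)
  have bound0: "norm k \<le> M * N * norm h" if mem: "(h, k) \<in> R0" for h k
  proof -
    obtain I r where I: "finite I" "I \<subseteq> {(tens f g, tens (A f) (B g)) | f g. True}"
        "(h, k) = (\<Sum>i\<in>I. r i *\<^sub>C i)"
      using cspan_explicitE[OF mem[unfolded R0_def]] .
    then have "\<forall>i\<in>I. \<exists>fg. i = (tens (fst fg) (snd fg), tens (A (fst fg)) (B (snd fg)))"
      by fastforce
    then obtain \<phi> where \<phi>: "\<forall>i\<in>I. i = (tens (fst (\<phi> i)) (snd (\<phi> i)),
        tens (A (fst (\<phi> i))) (B (snd (\<phi> i))))"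
      by metis
    define x where "x i = r i *\<^sub>C fst (\<phi> i)" for i
    have "r i *\<^sub>C i = (tens (x i) (snd (\<phi> i)), tens (A (x i)) (B (snd (\<phi> i))))" if "i \<in> I" for i
    proof -
      have "r i *\<^sub>C i = r i *\<^sub>C (tens (fst (\<phi> i)) (snd (\<phi> i)), tens (A (fst (\<phi> i))) (B (snd (\<phi> i))))"
        using \<phi> that by metis
      then show ?thesis
        by (simp add: scaleC_prod_def x_def tens_scaleC_left bounded_clinearD(5)[OF A])
    qed
    then have "(h, k) = (\<Sum>i\<in>I. (tens (x i) (snd (\<phi> i)), tens (A (x i)) (B (snd (\<phi> i)))))"
      unfolding I(3) by (intro sum.cong) auto
    then have "h = (\<Sum>i\<in>I. tens (x i) (snd (\<phi> i)))" "k = (\<Sum>i\<in>I. tens (A (x i)) (B (snd (\<phi> i))))"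
      by (simp_all add: sum_prod)
    then show ?thesis
      using norm_sum_tens_le[OF I(1) A B MN(2,4,1,3)] by simp
  qed
  have bound: "norm k \<le> M * N * norm h" if "(h, k) \<in> R" for h k
  proof -
    have "closed {p :: 'c \<times> 'c. norm (snd p) \<le> M * N * norm (fst p)}"
      by (intro closed_Collect_le continuous_intros)
    then have "R \<subseteq> {p. norm (snd p) \<le> M * N * norm (fst p)}"
      unfolding R_def by (intro closure_minimal) (auto intro: bound0)
    then show ?thesis
      using that by auto
  qed
  \<comment> \<open>Two values at \<open>h\<close> give the pair \<open>(0, k - k')\<close> in
    \<open>R\<close>, and the norm bound makes its second entry zero.\<close>
  have unique: "k = k'" if "(h, k) \<in> R" "(h, k') \<in> R" for h k k'
    using bound[of 0 "k - k'"] complex_vector.subspace_diff[OF sub that] by simp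
  have total: "\<exists>k. (h, k) \<in> R" for h
  proof -
    have "h \<in> closure (cspan {tens f g | f g. True})"
      unfolding dense_tens by simp
    then obtain hs where hs: "\<And>n. hs n \<in> cspan {tens f g | f g. True}" "hs \<longlonglongrightarrow> h"
      unfolding closure_sequential by blast
    have "\<exists>k. (h, k) \<in> R0" if "h \<in> cspan {tens f g | f g. True}" for h
      using that by (rule cspan_tensE) (use R0_sum in auto)
    then have "\<forall>n. \<exists>k. (hs n, k) \<in> R0"
      using hs(1) by simp
    from choice[OF this] obtain ks where "\<forall>n. (hs n, ks n) \<in> R0" ..
    then have ks: "(hs n, ks n) \<in> R0" for n ..
    have "Cauchy ks"
    proof (rule metric_CauchyI)
      fix e :: real assume e: "0 < e"
      \<comment> \<open>The summand 1 keeps the denominator positive when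
        \<open>M * N = 0\<close>.\<close>
      have "0 < e / (M * N + 1)"
        using e MN by (simp add: add_nonneg_pos)
      then obtain n0 where n0: "\<And>m n. m \<ge> n0 \<Longrightarrow> n \<ge> n0 \<Longrightarrow> dist (hs m) (hs n) < e / (M * N + 1)"
        using metric_CauchyD[OF LIMSEQ_imp_Cauchy[OF hs(2)]] by blast
      have "dist (ks m) (ks n) < e" if "m \<ge> n0" "n \<ge> n0" for m n
      proof -
        have "dist (ks m) (ks n) \<le> M * N * dist (hs m) (hs n)"
          unfolding dist_norm using complex_vector.subspace_diff[OF R0_sub ks[of m] ks[of n]]
          by (intro bound0) simp
        also have "\<dots> \<le> (M * N + 1) * dist (hs m) (hs n)"
          by (intro mult_right_mono) auto
        also have "\<dots> < e"
          using n0[OF that] MN by (simp add: pos_less_divide_eq add_nonneg_pos mult.commute)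
        finally show ?thesis .
      qed
      then show "\<exists>M. \<forall>m\<ge>M. \<forall>n\<ge>M. dist (ks m) (ks n) < e"
        by blast
    qed
    then obtain k where "ks \<longlonglongrightarrow> k"
      using Cauchy_convergent convergent_def by metis
    then have "(\<lambda>n. (hs n, ks n)) \<longlonglongrightarrow> (h, k)"
      using hs(2) by (rule tendsto_Pair[rotated])
    then have "(h, k) \<in> R"
      unfolding R_def closure_sequential using ks by (intro exI[of _ "\<lambda>n. (hs n, ks n)"]) simp
    then show ?thesis ..
  qed
  define C where "C h = (THE k. (h, k) \<in> R)" for h
  have C: "(h, C h) \<in> R" for h
    unfolding C_def using theI'[of "\<lambda>k. (h, k) \<in> R"] total unique by blast
  have C_eq: "C h = k" if "(h, k) \<in> R" for h k
    using C that by (rule unique)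
  have add: "C (h + h') = C h + C h'" for h h'
    using complex_vector.subspace_add[OF sub C[of h] C[of h']] by (intro C_eq) simp
  have scale: "C (c *\<^sub>C h) = c *\<^sub>C C h" for c h
    using complex_vector.subspace_scale[OF sub C[of h], of c]
    by (intro C_eq) (simp add: scaleC_prod_def)
  have "bounded_linear C"
  proof (rule bounded_linear_intro)
    show "C (r *\<^sub>R h) = r *\<^sub>R C h" for r h
      using scale[of "complex_of_real r" h] by (simp add: scaleC_of_real)
    show "norm (C h) \<le> norm h * (M * N)" for h
      using bound[OF C[of h]] by (simp add: mult.commute)
  qed (rule add)
  moreover have "C (tens f g) = tens (A f) (B g)" for f g
    using R0_tens closure_subset unfolding R_def by (intro C_eq) (auto simp: R_def)
  ultimately show ?thesis
    using scale unfolding bounded_clinear_def by blast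
qed

lemma bounded_clinear_eqI:
  fixes C D :: "'c \<Rightarrow> 'c"
  assumes "bounded_clinear C" "bounded_clinear D" "\<And>f g. C (tens f g) = D (tens f g)"
  shows "C = D"
proof
  fix h
  show "C h = D h"
  proof (rule dense_induct[where Q = "\<lambda>h. C h = D h"])
    show "closed {h. C h = D h}"
      using assms(1,2) by (intro closed_Collect_eq linear_continuous_on bounded_clinearD(1))
  qed (simp add: bounded_clinearD(6)[OF assms(1)] bounded_clinearD(6)[OF assms(2)] assms(3))
qed

text \<open>Existence together with uniqueness by density is what gives the definite description in
  \<open>tensor_bounded\<close> its meaning.\<close>

lemma
  assumes "bounded_clinear A" "bounded_clinear B"
  shows bounded_clinear_tensor_bounded: "bounded_clinear (tensor_bounded tens A B)"
    and tensor_bounded_tens: "tensor_bounded tens A B (tens f g) = tens (A f) (B g)"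
proof -
  obtain C where C: "bounded_clinear C" "\<forall>f g. C (tens f g) = tens (A f) (B g)"
    using tensor_bounded_exists[OF assms] by blast
  have uniq: "D = C" if "bounded_clinear D \<and> (\<forall>f g. D (tens f g) = tens (A f) (B g))" for D
    using that C by (intro bounded_clinear_eqI) auto
  have "tensor_bounded tens A B = C"
    unfolding tensor_bounded_def
  proof (rule the_equality)
    show "bounded_clinear C \<and> (\<forall>f g. C (tens f g) = tens (A f) (B g))"
      using C by blast
  qed (rule uniq)
  then show "bounded_clinear (tensor_bounded tens A B)"
    "tensor_bounded tens A B (tens f g) = tens (A f) (B g)"
    using C by auto
qed

lemma tensor_bounded_sum:
  assumes "bounded_clinear A" "bounded_clinear B"
  shows "tensor_bounded tens A B (\<Sum>i\<in>I. tens (x i) (x' i)) = (\<Sum>i\<in>I. tens (A (x i)) (B (x' i)))"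
  by (simp add: bounded_clinearD(6)[OF bounded_clinear_tensor_bounded[OF assms]]
      tensor_bounded_tens[OF assms])

end

section \<open>Definiteness and cross terms of tensor products of operators\<close>

lemma bounded_clinear_continuous_on:
  "bounded_clinear A \<Longrightarrow> continuous_on S g \<Longrightarrow> continuous_on S (\<lambda>x. A (g x))"
  by (rule bounded_linear.continuous_on[OF bounded_clinearD(1)])

context hilbert_tensor
begin

lemma tens_diff_left: "tens (f - f') g = tens f g - tens f' g"
  by (metis add_diff_cancel diff_add_cancel tens_add_left)

lemma tens_diff_right: "tens f (g - g') = tens f g - tens f g'"
  by (metis add_diff_cancel diff_add_cancel tens_add_right)

lemma tens_scaleR_right: "tens f (r *\<^sub>R g) = r *\<^sub>R tens f g"
  using tens_scaleC_right[of f "complex_of_real r"] by (simp add: scaleC_of_real)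

lemma tensor_bounded_scaleR:
  assumes "bounded_clinear A" "bounded_clinear B"
  shows "tensor_bounded tens (\<lambda>f. r *\<^sub>R A f) (\<lambda>g. s *\<^sub>R B g) h = (r * s) *\<^sub>R tensor_bounded tens A B h"
proof -
  have "tensor_bounded tens (\<lambda>f. r *\<^sub>R A f) (\<lambda>g. s *\<^sub>R B g) = (\<lambda>h. (r * s) *\<^sub>R tensor_bounded tens A B h)"
    using assms
    by (intro bounded_clinear_eqI bounded_clinear_tensor_bounded bounded_clinear_scaleR)
      (simp_all add: tensor_bounded_tens bounded_clinear_scaleR tens_scaleR_left tens_scaleR_right)
  then show ?thesis
    by simp
qed

text \<open>The kernels of \<open>A\<close> and \<open>B\<close> dominate \<open>a\<close> and
  \<open>b\<close> times Gram kernels; the latter are positive semidefinite because \<open>a\<close>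
  and \<open>b\<close> are nonnegative, so the products compare. Describing the subspace as the
  image of \<open>PQ\<close> leaves \<open>h\<close> unrestricted, as \<open>dense_induct\<close>
  demands.\<close>

lemma tensor_lower_bound:
  assumes A: "bounded_clinear A" "\<And>f g. cinner (A f) g = cinner f (A g)"
    and B: "bounded_clinear B" "\<And>f g. cinner (B f) g = cinner f (B g)"
    and P: "bounded_clinear P" and Q: "bounded_clinear Q"
    and a: "\<And>u. u \<in> range P \<Longrightarrow> a * (norm u)\<^sup>2 \<le> Re (cinner (A u) u)" "0 \<le> a"
    and b: "\<And>u. u \<in> range Q \<Longrightarrow> b * (norm u)\<^sup>2 \<le> Re (cinner (B u) u)" "0 \<le> b"
  defines "PQ \<equiv> tensor_bounded tens P Q"
  shows "a * b * (norm (PQ h))\<^sup>2 \<le> Re (cinner (tensor_bounded tens A B (PQ h)) (PQ h))"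
proof (rule dense_induct[where h = h])
  have AB: "bounded_clinear (tensor_bounded tens A B)"
    by (rule bounded_clinear_tensor_bounded[OF A(1) B(1)])
  have clinear: "bounded_clinear PQ"
    unfolding PQ_def by (rule bounded_clinear_tensor_bounded[OF P Q])
  show "closed {h. a * b * (norm (PQ h))\<^sup>2 \<le> Re (cinner (tensor_bounded tens A B (PQ h)) (PQ h))}"
    by (intro closed_Collect_le continuous_intros bounded_clinear_continuous_on[OF AB]
        bounded_clinear_continuous_on[OF clinear])
next
  fix I :: "'c set" and x x'
  assume fin: "finite I"
  have PQ: "PQ (\<Sum>i\<in>I. tens (x i) (x' i)) = (\<Sum>i\<in>I. tens (P (x i)) (Q (x' i)))"
    unfolding PQ_def by (rule tensor_bounded_sum[OF P Q])
  have "Re (\<Sum>i\<in>I. \<Sum>j\<in>I. (complex_of_real a * cinner (P (x i)) (P (x j)))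
          * (complex_of_real b * cinner (Q (x' i)) (Q (x' j))))
      \<le> Re (\<Sum>i\<in>I. \<Sum>j\<in>I. cinner (A (P (x i))) (P (x j)) * cinner (B (Q (x' i))) (Q (x' j)))"
  proof (rule psd_schur_product_mono[OF fin])
    show "psd I (\<lambda>i j. cinner (A (P (x i))) (P (x j)) - complex_of_real a * cinner (P (x i)) (P (x j)))"
      by (rule psd_lower_bound[OF A csubspace_range[OF P] rangeI a(1)])
    show "psd I (\<lambda>i j. cinner (B (Q (x' i))) (Q (x' j)) - complex_of_real b * cinner (Q (x' i)) (Q (x' j)))"
      by (rule psd_lower_bound[OF B csubspace_range[OF Q] rangeI b(1)])
  qed (intro psd_scale psd_gram a b)+
  also have "(\<Sum>i\<in>I. \<Sum>j\<in>I. (complex_of_real a * cinner (P (x i)) (P (x j)))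
          * (complex_of_real b * cinner (Q (x' i)) (Q (x' j))))
      = complex_of_real (a * b) * cinner (PQ (\<Sum>i\<in>I. tens (x i) (x' i))) (PQ (\<Sum>i\<in>I. tens (x i) (x' i)))"
    unfolding PQ cinner_tens_sum sum_distrib_left by (intro sum.cong refl) simp
  finally show "a * b * (norm (PQ (\<Sum>i\<in>I. tens (x i) (x' i))))\<^sup>2
      \<le> Re (cinner (tensor_bounded tens A B (PQ (\<Sum>i\<in>I. tens (x i) (x' i)))) (PQ (\<Sum>i\<in>I. tens (x i) (x' i))))"
    by (simp add: PQ tensor_bounded_sum[OF A(1) B(1)] cinner_tens_sum cinner_self
        del: of_real_power)
qed

text \<open>This is the lower half of the cross estimate with constant \<open>k * l\<close>, with
  the product of norms replaced by weighted squares. The doubled index set lets the vectors of both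
  blocks enter the same pair of kernels.\<close>

lemma tensor_cross_bound:
  assumes A: "bounded_clinear A" "\<And>f g. cinner (A f) g = cinner f (A g)"
    and B: "bounded_clinear B" "\<And>f g. cinner (B f) g = cinner f (B g)"
    and P: "bounded_clinear P" "bounded_clinear P'" and Q: "bounded_clinear Q" "bounded_clinear Q'"
    and k: "\<And>u v. u \<in> range P \<Longrightarrow> v \<in> range P' \<Longrightarrow> cmod (cinner (A u) v) \<le> k * norm u * norm v"
      "0 \<le> k"
    and l: "\<And>u v. u \<in> range Q \<Longrightarrow> v \<in> range Q' \<Longrightarrow> cmod (cinner (B u) v) \<le> l * norm u * norm v"
      "0 \<le> l"
    and t: "0 < t"
  defines "C \<equiv> tensor_bounded tens A B"
    and "R \<equiv> tensor_bounded tens P Q" and "R' \<equiv> tensor_bounded tens P' Q'"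
  shows "0 \<le> k * l * t * (norm (R h))\<^sup>2 + k * l / t * (norm (R' h))\<^sup>2
    + (Re (cinner (C (R h)) (R' h)) + Re (cinner (C (R' h)) (R h)))"
proof (rule dense_induct[where h = h])
  have C: "bounded_clinear C" and R: "bounded_clinear R" and R': "bounded_clinear R'"
    unfolding C_def R_def R'_def using A(1) B(1) P Q by (auto intro: bounded_clinear_tensor_bounded)
  show "closed {h. 0 \<le> k * l * t * (norm (R h))\<^sup>2 + k * l / t * (norm (R' h))\<^sup>2
    + (Re (cinner (C (R h)) (R' h)) + Re (cinner (C (R' h)) (R h)))}"
    by (intro closed_Collect_le continuous_intros bounded_clinear_continuous_on[OF C]
        bounded_clinear_continuous_on[OF R] bounded_clinear_continuous_on[OF R'])
next
  fix I :: "'c set" and x x'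
  assume fin: "finite I"
  let ?h = "\<Sum>i\<in>I. tens (x i) (x' i)"
  define y where "y = (\<lambda>p. if snd p then P (x (fst p)) else P' (x (fst p)))"
  define y' where "y' = (\<lambda>p. if snd p then Q (x' (fst p)) else Q' (x' (fst p)))"
  define K where "K = (\<lambda>p q. if snd p = snd q
      then complex_of_real (if snd p then k * t else k / t) * cinner (y p) (y q)
      else cinner (A (y p)) (y q))"
  \<comment> \<open>The weights of the two kernels multiply, so all of \<open>t\<close> is placed in
    \<open>K\<close> and \<open>L\<close> gets weight 1.\<close>
  define L where "L = (\<lambda>p q. if snd p = snd q
      then complex_of_real (if snd p then l * 1 else l / 1) * cinner (y' p) (y' q)
      else cinner (B (y' p)) (y' q))"
  have R_eq: "R ?h = (\<Sum>i\<in>I. tens (P (x i)) (Q (x' i)))" "R' ?h = (\<Sum>i\<in>I. tens (P' (x i)) (Q' (x' i)))"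
    unfolding R_def R'_def
    by (rule tensor_bounded_sum[OF P(1) Q(1)], rule tensor_bounded_sum[OF P(2) Q(2)])
  have "psd (I \<times> UNIV) K"
    unfolding K_def
    by (rule psd_twisted_gram[OF fin A csubspace_range[OF P(1)] _ csubspace_range[OF P(2)] _ k t])
      (simp_all add: y_def)
  moreover have "psd (I \<times> UNIV) L"
    unfolding L_def
    by (rule psd_twisted_gram[OF fin B csubspace_range[OF Q(1)] _ csubspace_range[OF Q(2)] _ l zero_less_one])
      (simp_all add: y'_def)
  ultimately have "0 \<le> Re (\<Sum>p\<in>I \<times> UNIV. \<Sum>q\<in>I \<times> UNIV. K p q * L p q)"
    using fin by (intro psd_schur_product) auto
  also have "(\<Sum>p\<in>I \<times> UNIV. \<Sum>q\<in>I \<times> UNIV. K p q * L p q)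
      = complex_of_real (k * l * t) * cinner (R ?h) (R ?h) + cinner (C (R ?h)) (R' ?h)
        + (cinner (C (R' ?h)) (R ?h) + complex_of_real (k * l / t) * cinner (R' ?h) (R' ?h))"
    unfolding R_eq C_def tensor_bounded_sum[OF A(1) B(1)] cinner_tens_sum sum_times_bool[OF fin]
    by (simp add: K_def L_def y_def y'_def sum.distrib sum_distrib_left mult_ac)
  finally show "0 \<le> k * l * t * (norm (R ?h))\<^sup>2 + k * l / t * (norm (R' ?h))\<^sup>2
    + (Re (cinner (C (R ?h)) (R' ?h)) + Re (cinner (C (R' ?h)) (R ?h)))"
    by (simp add: cinner_self del: of_real_power of_real_mult of_real_divide)
qed

text \<open>The lower bounds of the blocks outweigh the cross terms exactly when the 2x2 matrix with
  diagonal \<open>a\<close>, \<open>b\<close> and off-diagonal entries \<open>- (k * l)\<close> is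
  positive definite.\<close>

lemma tensor_lower_bound_pair:
  assumes A: "bounded_clinear A" "\<And>f g. cinner (A f) g = cinner f (A g)"
    and B: "bounded_clinear B" "\<And>f g. cinner (B f) g = cinner f (B g)"
    and P: "bounded_clinear P" "bounded_clinear P'" and Q: "bounded_clinear Q" "bounded_clinear Q'"
    and k: "\<And>u v. u \<in> range P \<Longrightarrow> v \<in> range P' \<Longrightarrow> cmod (cinner (A u) v) \<le> k * norm u * norm v"
      "0 \<le> k"
    and l: "\<And>u v. u \<in> range Q \<Longrightarrow> v \<in> range Q' \<Longrightarrow> cmod (cinner (B u) v) \<le> l * norm u * norm v"
      "0 \<le> l"
  defines "C \<equiv> tensor_bounded tens A B"
    and "R \<equiv> tensor_bounded tens P Q" and "R' \<equiv> tensor_bounded tens P' Q'"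
  assumes a: "\<And>h. a * (norm (R h))\<^sup>2 \<le> Re (cinner (C (R h)) (R h))" "0 < a"
    and b: "\<And>h. b * (norm (R' h))\<^sup>2 \<le> Re (cinner (C (R' h)) (R' h))" "0 < b"
    and small: "(k * l)\<^sup>2 < a * b"
  shows "\<exists>c>0. \<forall>h. c * (norm (R h + R' h))\<^sup>2 \<le> Re (cinner (C (R h + R' h)) (R h + R' h))"
proof -
  have C: "bounded_clinear C"
    unfolding C_def by (rule bounded_clinear_tensor_bounded[OF A(1) B(1)])
  \<comment> \<open>The balancing weight: with it \<open>k * l * t < a\<close> and
    \<open>k * l / t < b\<close> both say \<open>k * l < sqrt a * sqrt b\<close>.\<close>
  define t where "t = sqrt a / sqrt b"
  have t: "0 < t"
    using a b by (simp add: t_def)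
  have kl: "k * l < sqrt a * sqrt b"
    using small k(2) l(2) a b by (simp add: real_less_rsqrt flip: real_sqrt_mult)
  have kt: "k * l * t < a"
  proof -
    have "k * l * t < sqrt a * sqrt b * t"
      using kl t by (rule mult_strict_right_mono)
    also have "\<dots> = a"
      using a b by (simp add: t_def)
    finally show ?thesis .
  qed
  have kt': "k * l / t < b"
  proof -
    have "k * l / t < sqrt a * sqrt b / t"
      using kl t by (rule divide_strict_right_mono)
    also have "\<dots> = b"
      using a b by (simp add: t_def)
    finally show ?thesis .
  qed
  define c where "c = min (a - k * l * t) (b - k * l / t)"
  have c: "0 < c"
    using kt kt' by (simp add: c_def)
  \<comment> \<open>\<open>R h\<close> and \<open>R' h\<close> need not be orthogonal, so the
    squared norm of their sum is only bounded by twice the sum of squares; hence the factor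
    1/2.\<close>
  have "c / 2 * (norm (R h + R' h))\<^sup>2 \<le> Re (cinner (C (R h + R' h)) (R h + R' h))" for h
  proof -
    define x y where "x = norm (R h)" and "y = norm (R' h)"
    have "(norm (R h + R' h))\<^sup>2 \<le> (x + y)\<^sup>2"
      unfolding x_def y_def by (intro power_mono norm_triangle_ineq) simp
    also have "\<dots> \<le> 2 * (x\<^sup>2 + y\<^sup>2)"
      using zero_le_power2[of "x - y"] by (simp add: power2_eq_square algebra_simps)
    finally have "c / 2 * (norm (R h + R' h))\<^sup>2 \<le> c / 2 * (2 * (x\<^sup>2 + y\<^sup>2))"
      using c by (intro mult_left_mono) auto
    also have "\<dots> = c * x\<^sup>2 + c * y\<^sup>2"
      by (simp add: algebra_simps)
    also have "\<dots> \<le> (a - k * l * t) * x\<^sup>2 + (b - k * l / t) * y\<^sup>2"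
      by (intro add_mono mult_right_mono) (simp_all add: c_def)
    also have "\<dots> = a * x\<^sup>2 + b * y\<^sup>2 - (k * l * t * x\<^sup>2 + k * l / t * y\<^sup>2)"
      by (simp add: algebra_simps)
    also have "\<dots> \<le> Re (cinner (C (R h)) (R h)) + Re (cinner (C (R' h)) (R' h))
        + (Re (cinner (C (R h)) (R' h)) + Re (cinner (C (R' h)) (R h)))"
      using a(1)[of h] b(1)[of h] tensor_cross_bound[OF A B P Q k l t, of h]
      unfolding C_def[symmetric] R_def[symmetric] R'_def[symmetric] x_def y_def by linarith
    also have "\<dots> = Re (cinner (C (R h + R' h)) (R h + R' h))"
      by (simp add: bounded_clinearD(2)[OF C] cinner_add_left cinner_add_right)
    finally show ?thesis .
  qed
  then show ?thesis
    using c by (intro exI[of _ "c / 2"]) simp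
qed

end


section \<open>Compressions and approximate eigensequences\<close>

text \<open>The operator inclusion \<open>Q S \<subseteq> T Q\<close>, read on graphs. It lets
  \<open>Q\<close> carry approximate eigensequences of \<open>S\<close> to approximate solutions for
  \<open>T\<close>, without normalisation.\<close>

definition compresses :: "('c::chilbert_space \<Rightarrow> 'c) \<Rightarrow> 'c operator \<Rightarrow> 'c operator \<Rightarrow> bool"
  where "compresses Q S T \<longleftrightarrow>
    bounded_clinear Q \<and> (\<forall>f g. (f, g) \<in> op_graph S \<longrightarrow> (Q f, Q g) \<in> op_graph T)"

lemma compresses_dsum:
  assumes "compresses Q S T" "compresses Q' S T'"
  shows "compresses (\<lambda>f. Q f + Q' f) S (T \<oplus>\<^sub>o T')"
  using assms bounded_clinear_add unfolding compresses_def op_dsum_def by fastforce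

text \<open>Since \<open>Q\<close> intertwines, \<open>T - z\<close> maps \<open>Q (f n)\<close> to
  \<open>Q (g n - z *\<^sub>C f n)\<close>, which tends to 0; the inverse bound for
  \<open>T - z\<close> forces \<open>Q (f n)\<close> to do the same.\<close>

lemma approx_eigenseq_compress_tendsto_zero:
  assumes Q: "compresses Q S T" and z: "z \<notin> spectrum T" and f: "approx_eigenseq S z f"
  shows "(\<lambda>n. Q (f n)) \<longlonglongrightarrow> 0"
proof -
  obtain g where g: "\<And>n. (f n, g n) \<in> op_graph S" "(\<lambda>n. norm (g n - z *\<^sub>C f n)) \<longlonglongrightarrow> 0"
    using f unfolding approx_eigenseq_def by blast
  have lin: "bounded_clinear Q"
    using Q unfolding compresses_def by blast
  obtain C where C: "has_inverse_bound (op_shift T z) C"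
    using z unfolding spectrum_def resolvent_set_def by blast
  have bound: "norm (Q (f n)) \<le> C * norm (Q (g n - z *\<^sub>C f n))" for n
  proof -
    have "(Q (f n), Q (g n)) \<in> op_graph T"
      using Q g(1) unfolding compresses_def by blast
    then have "(Q (f n), Q (g n) - z *\<^sub>C Q (f n)) \<in> op_graph (op_shift T z)"
      unfolding op_shift_def by auto
    then have "norm (Q (f n)) \<le> C * norm (Q (g n) - z *\<^sub>C Q (f n))"
      using C unfolding has_inverse_bound_def by blast
    then show ?thesis
      by (simp add: bounded_clinearD(3,5)[OF lin])
  qed
  have "(\<lambda>n. Q (g n - z *\<^sub>C f n)) \<longlonglongrightarrow> 0"
    by (intro bounded_linear.tendsto_zero[OF bounded_clinearD(1)[OF lin]])
      (use g(2) in \<open>simp add: tendsto_norm_zero_iff\<close>)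
  then have "(\<lambda>n. C * norm (Q (g n - z *\<^sub>C f n))) \<longlonglongrightarrow> 0"
    by (intro tendsto_mult_right_zero tendsto_norm_zero)
  then show ?thesis
    by (rule Lim_null_comparison[rotated]) (simp add: bound)
qed

lemma app_spectrum_mono: "op_graph S \<subseteq> op_graph T \<Longrightarrow> app_spectrum S \<subseteq> app_spectrum T"
  unfolding app_spectrum_def approx_eigenseq_def by blast

text \<open>Multiplying the form of \<open>J\<close> by this factor turns negative type into
  positive type, so both signs share one argument.\<close>

fun sign_value :: "sign \<Rightarrow> real" where
  "sign_value Pos = 1"
| "sign_value Neg = - 1"

text \<open>An approximate eigensequence agrees in the limit with its image under \<open>Q\<close>;
  the images have norms tending to 1, and there the signed form of \<open>J\<close> is at least
  \<open>c\<close> times the squared norm. Any constant below \<open>c\<close>, here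
  \<open>c / 2\<close>, is then an eventual bound along the sequence.\<close>

lemma def_spectrumI:
  assumes J: "bounded_clinear J" and Q: "bounded_clinear Q" and z: "z \<in> app_spectrum S"
    and lim: "\<And>f. approx_eigenseq S z f \<Longrightarrow> (\<lambda>n. f n - Q (f n)) \<longlonglongrightarrow> 0"
    and c: "0 < c" "\<And>h. c * (norm (Q h))\<^sup>2 \<le> sign_value \<mu> * Re (cinner (J (Q h)) (Q h))"
  shows "z \<in> def_spectrum \<mu> J S"
proof -
  have ev: "eventually (\<lambda>n. c / 2 \<le> sign_value \<mu> * Re (cinner (J (f n)) (f n))) sequentially"
    if f: "approx_eigenseq S z f" for f
  proof -
    define r where "r n = f n - Q (f n)" for n
    have r: "r \<longlonglongrightarrow> 0"
      unfolding r_def using lim[OF f] .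
    have norm_f: "norm (f n) = 1" for n
      using f unfolding approx_eigenseq_def by blast
    have "(\<lambda>n. norm (r n)) \<longlonglongrightarrow> 0"
      using r by (rule tendsto_norm_zero)
    moreover have "\<bar>norm (Q (f n)) - 1\<bar> \<le> norm (r n)" for n
      using norm_triangle_ineq3[of "f n" "Q (f n)"] norm_f[of n] by (simp add: r_def abs_minus_commute)
    ultimately have "(\<lambda>n. norm (Q (f n)) - 1) \<longlonglongrightarrow> 0"
      by (intro Lim_null_comparison[of "\<lambda>n. norm (Q (f n)) - 1" "\<lambda>n. norm (r n)"]) simp_all
    then have norm_Q: "(\<lambda>n. norm (Q (f n))) \<longlonglongrightarrow> 1"
      by (simp add: LIM_zero_iff)
    obtain K where K: "\<And>h. norm (J h) \<le> norm h * K"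
      using bounded_linear.bounded[OF bounded_clinearD(1)[OF J]] by blast
    \<comment> \<open>Collects the terms of the form of \<open>J\<close> at
      \<open>f n = r n + Q (f n)\<close> that contain \<open>r n\<close>.\<close>
    define d where "d n = cinner (J (r n)) (f n) + cinner (J (Q (f n))) (r n)" for n
    have "norm (d n) \<le> norm (r n) * K + norm (Q (f n)) * K * norm (r n)" for n
    proof -
      have "cmod (cinner (J (r n)) (f n)) \<le> norm (J (r n))"
        using cmod_cinner_le[of "J (r n)" "f n"] norm_f[of n] by simp
      moreover have "cmod (cinner (J (Q (f n))) (r n)) \<le> norm (Q (f n)) * K * norm (r n)"
        using cmod_cinner_le[of "J (Q (f n))" "r n"] K[of "Q (f n)"]
        by (meson mult_right_mono norm_ge_zero order_trans)
      ultimately show ?thesis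
        unfolding d_def using K[of "r n"]
          norm_triangle_ineq[of "cinner (J (r n)) (f n)" "cinner (J (Q (f n))) (r n)"]
        by linarith
    qed
    moreover have "(\<lambda>n. norm (r n) * K + norm (Q (f n)) * K * norm (r n)) \<longlonglongrightarrow> 0 * K + 1 * K * 0"
      using r norm_Q by (intro tendsto_intros tendsto_norm_zero)
    ultimately have "d \<longlonglongrightarrow> 0"
      by (intro Lim_null_comparison[of d "\<lambda>n. norm (r n) * K + norm (Q (f n)) * K * norm (r n)"])
        simp_all
    then have "(\<lambda>n. sign_value \<mu> * Re (d n) + c * (norm (Q (f n)))\<^sup>2)
        \<longlonglongrightarrow> sign_value \<mu> * Re 0 + c * 1\<^sup>2"
      using norm_Q by (intro tendsto_intros)
    then have "eventually (\<lambda>n. c / 2 < sign_value \<mu> * Re (d n) + c * (norm (Q (f n)))\<^sup>2) sequentially"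
      by (rule order_tendstoD) (use c(1) in simp)
    then show ?thesis
    proof eventually_elim
      case (elim n)
      have "f n = r n + Q (f n)"
        by (simp add: r_def)
      then have "cinner (J (f n)) (f n) = d n + cinner (J (Q (f n))) (Q (f n))"
        unfolding d_def by (metis add.assoc bounded_clinearD(2)[OF J] cinner_add_left cinner_add_right)
      then show ?case
        using elim c(2)[of "f n"] by (simp add: algebra_simps)
    qed
  qed
  have "case \<mu> of
      Pos \<Rightarrow> liminf (\<lambda>n. ereal (Re (cinner (J (f n)) (f n)))) > 0
    | Neg \<Rightarrow> limsup (\<lambda>n. ereal (Re (cinner (J (f n)) (f n)))) < 0"
    if "approx_eigenseq S z f" for f
  proof (cases \<mu>)
    case Pos
    have "ereal (c / 2) \<le> liminf (\<lambda>n. ereal (Re (cinner (J (f n)) (f n))))"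
      by (rule Liminf_bounded) (use ev[OF that] Pos in simp)
    then show ?thesis
      using c(1) Pos by (auto intro: less_le_trans[of 0 "ereal (c / 2)"])
  next
    case Neg
    have "limsup (\<lambda>n. ereal (Re (cinner (J (f n)) (f n)))) \<le> ereal (- (c / 2))"
      by (rule Limsup_bounded) (use ev[OF that] Neg in \<open>auto elim!: eventually_mono\<close>)
    then show ?thesis
      using c(1) Neg by (auto intro: le_less_trans[of _ "ereal (- (c / 2))"])
  qed
  with z show ?thesis
    unfolding def_spectrum_def by blast
qed

section \<open>Compressions and inclusions of tensor sums of operators\<close>

lemma op_addE:
  assumes "(f, k) \<in> op_graph (op_add A B)"
  obtains g h where "k = g + h" "(f, g) \<in> op_graph A" "(f, h) \<in> op_graph B"
  using assms unfolding op_add_def operator.sel by blast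

lemma op_addI:
  "(f, g) \<in> op_graph A \<Longrightarrow> (f, h) \<in> op_graph B \<Longrightarrow> (f, g + h) \<in> op_graph (op_add A B)"
  unfolding op_add_def operator.sel by blast

lemma compresses_closure:
  assumes "bounded_clinear C" "\<And>f g. (f, g) \<in> G \<Longrightarrow> (C f, C g) \<in> H"
    and "(f, g) \<in> closure G"
  shows "(C f, C g) \<in> closure H"
proof -
  let ?C = "\<lambda>p. (C (fst p), C (snd p))"
  have "continuous_on (closure G) ?C"
    by (intro continuous_intros bounded_clinear_continuous_on[OF assms(1)])
  moreover have "?C ` G \<subseteq> closure H"
    using assms(2) closure_subset[of H] by auto
  ultimately have "?C ` closure G \<subseteq> closure H"
    by (intro image_closure_subset) auto
  from subsetD[OF this imageI[OF assms(3)]] show ?thesis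
    by simp
qed

context hilbert_tensor
begin

text \<open>The graph is a span of pairs and the preimage of the target graph under \<open>C\<close>
  acting on both components is a subspace, so the generating pairs decide.\<close>

lemma op_alg_tensor_compress:
  assumes C: "bounded_clinear C" "\<And>f g. C (tens f g) = tens (A f) (B g)"
    and A: "\<And>f g. (f, g) \<in> op_graph T1 \<Longrightarrow> (A f, A g) \<in> op_graph T1'"
    and B: "\<And>f g. (f, g) \<in> op_graph T2 \<Longrightarrow> (B f, B g) \<in> op_graph T2'"
    and fg: "(f, g) \<in> op_graph (op_alg_tensor tens T1 T2)"
  shows "(C f, C g) \<in> op_graph (op_alg_tensor tens T1' T2')"
proof -
  let ?G = "\<lambda>T1 T2. {(tens f f', tens g g') | f g f' g'. (f, g) \<in> op_graph T1 \<and> (f', g') \<in> op_graph T2}"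
  let ?H = "cspan (?G T1' T2')"
  have H: "csubspace ?H"
    by (rule complex_vector.subspace_span)
  have "(f, g) \<in> cspan (?G T1 T2)"
    using fg unfolding op_alg_tensor_def by simp
  then have "(C (fst (f, g)), C (snd (f, g))) \<in> ?H"
  proof (rule complex_vector.span_induct)
    show "csubspace {p. (C (fst p), C (snd p)) \<in> ?H}"
    proof (rule complex_vector.subspaceI)
      show "0 \<in> {p. (C (fst p), C (snd p)) \<in> ?H}"
        using complex_vector.subspace_0[OF H] by (simp add: bounded_clinearD(4)[OF C(1)] zero_prod_def)
    next
      fix p q assume "p \<in> {p. (C (fst p), C (snd p)) \<in> ?H}" "q \<in> {p. (C (fst p), C (snd p)) \<in> ?H}"
      then have "(C (fst p), C (snd p)) + (C (fst q), C (snd q)) \<in> ?H"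
        by (intro complex_vector.subspace_add[OF H]) (simp_all only: mem_Collect_eq)
      then show "p + q \<in> {p. (C (fst p), C (snd p)) \<in> ?H}"
        by (simp only: mem_Collect_eq fst_add snd_add bounded_clinearD(2)[OF C(1)] add_Pair)
    next
      fix c p assume "p \<in> {p. (C (fst p), C (snd p)) \<in> ?H}"
      then have "c *\<^sub>C (C (fst p), C (snd p)) \<in> ?H"
        by (intro complex_vector.subspace_scale[OF H]) (simp only: mem_Collect_eq)
      then show "c *\<^sub>C p \<in> {p. (C (fst p), C (snd p)) \<in> ?H}"
        by (simp only: mem_Collect_eq scaleC_prod_def fst_conv snd_conv bounded_clinearD(5)[OF C(1)])
    qed
  next
    fix p assume "p \<in> ?G T1 T2"
    then obtain f g f' g' where p: "p = (tens f f', tens g g')"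
        and "(f, g) \<in> op_graph T1" "(f', g') \<in> op_graph T2"
      by blast
    then have "(tens (A f) (B f'), tens (A g) (B g')) \<in> ?G T1' T2'"
      using A B by blast
    then show "(C (fst p), C (snd p)) \<in> ?H"
      unfolding p fst_conv snd_conv C(2) by (rule complex_vector.span_base)
  qed
  then show ?thesis
    unfolding op_alg_tensor_def by simp
qed

text \<open>Serves both directions between \<open>S\<close> and its parts: with projections as
  \<open>A\<close> and \<open>B\<close> it gives the compressions, with identities the inclusions of
  graphs.\<close>

lemma compresses_op_tensor_sum:
  assumes C: "bounded_clinear C" "\<And>f g. C (tens f g) = tens (A f) (B g)"
    and A: "\<And>f g. (f, g) \<in> op_graph T1 \<Longrightarrow> (A f, A g) \<in> op_graph T1'" "A ` op_space T1 \<subseteq> op_space T1'"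
    and B: "\<And>f g. (f, g) \<in> op_graph T2 \<Longrightarrow> (B f, B g) \<in> op_graph T2'" "B ` op_space T2 \<subseteq> op_space T2'"
  shows "compresses C (op_tensor_sum tens T1 T2) (op_tensor_sum tens T1' T2')"
proof -
  have id: "(A f, A g) \<in> op_graph (op_id (op_space T1'))"
    if "(f, g) \<in> op_graph (op_id (op_space T1))" for f g
    using that A(2) unfolding op_id_def by auto
  have id': "(B f, B g) \<in> op_graph (op_id (op_space T2'))"
    if "(f, g) \<in> op_graph (op_id (op_space T2))" for f g
    using that B(2) unfolding op_id_def by auto
  let ?S = "\<lambda>T1 T2. op_add (op_alg_tensor tens T1 (op_id (op_space T2)))
    (op_alg_tensor tens (op_id (op_space T1)) T2)"
  have sum: "(C f, C g) \<in> op_graph (?S T1' T2')" if mem: "(f, g) \<in> op_graph (?S T1 T2)" for f g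
  proof -
    obtain h k where g: "g = h + k"
        and h: "(f, h) \<in> op_graph (op_alg_tensor tens T1 (op_id (op_space T2)))"
        and k: "(f, k) \<in> op_graph (op_alg_tensor tens (op_id (op_space T1)) T2)"
      using op_addE[OF mem] .
    have "(C f, C h) \<in> op_graph (op_alg_tensor tens T1' (op_id (op_space T2')))"
      by (rule op_alg_tensor_compress[OF C A(1) id' h])
    moreover have "(C f, C k) \<in> op_graph (op_alg_tensor tens (op_id (op_space T1')) T2')"
      by (rule op_alg_tensor_compress[OF C id B(1) k])
    ultimately show ?thesis
      unfolding g bounded_clinearD(2)[OF C(1)] by (rule op_addI)
  qed
  show ?thesis
    unfolding compresses_def op_tensor_sum_def op_closure_def operator.sel
    using C(1) compresses_closure[OF C(1) sum] by blast
qed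

lemma op_tensor_sum_mono:
  assumes "op_graph T1 \<subseteq> op_graph T1'" "op_space T1 \<subseteq> op_space T1'"
    and "op_graph T2 \<subseteq> op_graph T2'" "op_space T2 \<subseteq> op_space T2'"
  shows "op_graph (op_tensor_sum tens T1 T2) \<subseteq> op_graph (op_tensor_sum tens T1' T2')"
proof -
  have "compresses (\<lambda>h. h) (op_tensor_sum tens T1 T2) (op_tensor_sum tens T1' T2')"
    using assms
    by (intro compresses_op_tensor_sum[where A = "\<lambda>f. f" and B = "\<lambda>g. g"] bounded_clinear_ident)
      auto
  then show ?thesis
    unfolding compresses_def by auto
qed

lemma op_tensor_sum_add:
  assumes "(f, g) \<in> op_graph (op_tensor_sum tens T1 T2)" "(f', g') \<in> op_graph (op_tensor_sum tens T1 T2)"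
  shows "(f + f', g + g') \<in> op_graph (op_tensor_sum tens T1 T2)"
proof -
  let ?A = "op_alg_tensor tens T1 (op_id (op_space T2))"
  let ?B = "op_alg_tensor tens (op_id (op_space T1)) T2"
  have A: "csubspace (op_graph ?A)" and B: "csubspace (op_graph ?B)"
    unfolding op_alg_tensor_def operator.sel by (rule complex_vector.subspace_span)+
  have sum: "p + q \<in> op_graph (op_add ?A ?B)"
    if p: "p \<in> op_graph (op_add ?A ?B)" and q: "q \<in> op_graph (op_add ?A ?B)" for p q
  proof -
    obtain g h where gh: "snd p = g + h" "(fst p, g) \<in> op_graph ?A" "(fst p, h) \<in> op_graph ?B"
      using op_addE[of "fst p" "snd p"] p unfolding prod.collapse .
    obtain g' h' where gh': "snd q = g' + h'" "(fst q, g') \<in> op_graph ?A" "(fst q, h') \<in> op_graph ?B"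
      using op_addE[of "fst q" "snd q"] q unfolding prod.collapse .
    have "(fst p + fst q, (g + g') + (h + h')) \<in> op_graph (op_add ?A ?B)"
      using complex_vector.subspace_add[OF A gh(2) gh'(2)] complex_vector.subspace_add[OF B gh(3) gh'(3)]
      by (intro op_addI) simp_all
    also have "(fst p + fst q, (g + g') + (h + h')) = p + q"
      by (simp add: prod_eq_iff gh gh' algebra_simps)
    finally show ?thesis .
  qed
  show ?thesis
    using closure_add_mem[of "op_graph (op_add ?A ?B)" "(f, g)" "(f', g')", OF sum] assms
    unfolding op_tensor_sum_def op_closure_def by simp
qed

lemma op_dsum_subset_op_tensor_sum:
  assumes "op_graph A \<subseteq> op_graph (op_tensor_sum tens T1 T2)" "op_graph B \<subseteq> op_graph (op_tensor_sum tens T1 T2)"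
  shows "op_graph (A \<oplus>\<^sub>o B) \<subseteq> op_graph (op_tensor_sum tens T1 T2)"
  unfolding op_dsum_def operator.sel using assms by (blast intro: op_tensor_sum_add)

end

lemma bounded_clinear_part_proj:
  assumes "\<And>\<mu>. bounded_clinear (P \<mu>)"
  shows "bounded_clinear (part_proj P \<mu>)"
  by (cases \<mu>) (auto simp: part_proj.simps[abs_def] intro!: bounded_clinear_diff bounded_clinear_ident assms)

text \<open>The commutation relation puts \<open>(P \<nu> f, P \<nu> g)\<close> into the graph of
  \<open>T\<close>; the remaining part follows by subtraction inside the graph, which is a
  subspace.\<close>

lemma part_proj_graph:
  assumes T: "linear_operator T"
    and commute: "\<And>\<mu>. op_graph T O fun_graph (P \<mu>) \<subseteq> fun_graph (P \<mu>) O op_graph T"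
    and fg: "(f, g) \<in> op_graph T"
  shows "(part_proj P \<mu> f, part_proj P \<mu> g) \<in> op_graph (part_op P T \<mu>)"
proof -
  have P: "(P \<nu> f, P \<nu> g) \<in> op_graph T" for \<nu>
  proof -
    have "(f, P \<nu> g) \<in> op_graph T O fun_graph (P \<nu>)"
      using fg unfolding fun_graph_def by blast
    then show ?thesis
      using commute[of \<nu>] unfolding fun_graph_def by blast
  qed
  have sub: "csubspace (op_graph T)"
    using T unfolding linear_operator_def by blast
  have "(part_proj P \<mu> f, part_proj P \<mu> g) \<in> op_graph T"
  proof (cases \<mu>)
    case Rest
    have "(f, g) - (P Pos f, P Pos g) - (P Neg f, P Neg g) \<in> op_graph T"
      by (intro complex_vector.subspace_diff[OF sub] fg P)
    then show ?thesis
      by (simp add: Rest)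
  qed (simp add: P)
  then show ?thesis
    unfolding part_op_def op_restrict_def by simp
qed

lemma sign_lower_bound:
  assumes "\<And>f. f \<in> range (P Pos) \<Longrightarrow> \<kappa> Pos * (norm f)\<^sup>2 \<le> Re (cinner (J f) f)"
    and "\<And>f. f \<in> range (P Neg) \<Longrightarrow> \<kappa> Neg * (norm f)\<^sup>2 \<le> - Re (cinner (J f) f)"
    and "f \<in> range (P \<mu>)"
  shows "\<kappa> \<mu> * (norm f)\<^sup>2 \<le> Re (cinner (sign_value \<mu> *\<^sub>R J f) f)"
  using assms by (cases \<mu>) (simp_all add: cinner_minus_left)

lemma hermitian_scaleR:
  assumes "\<And>f g. cinner (J f) g = cinner f (J g)"
  shows "cinner (r *\<^sub>R J f) g = cinner f (r *\<^sub>R J g)"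
  by (simp add: cinner_scaleR_left cinner_scaleR_right assms)


section \<open>Decomposition into definite parts\<close>

text \<open>Definiteness of either sign takes a single form here, with the sign moved into the
  involution.\<close>

locale definite_decomposition = hilbert_tensor tens
  for tens :: "'a::chilbert_space \<Rightarrow> 'b::chilbert_space \<Rightarrow> 'c::chilbert_space" +
  fixes T1 :: "'a operator" and T2 :: "'b operator"
    and J1 :: "'a \<Rightarrow> 'a" and J2 :: "'b \<Rightarrow> 'b"
    and P1 :: "sign \<Rightarrow> 'a \<Rightarrow> 'a" and P2 :: "sign \<Rightarrow> 'b \<Rightarrow> 'b"
    and \<kappa>1 \<kappa>2 :: "sign \<Rightarrow> real"
  assumes T1: "op_space T1 = UNIV" "linear_operator T1"
    and T2: "op_space T2 = UNIV" "linear_operator T2"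
    and J1: "bounded_clinear J1" "\<And>f g. cinner (J1 f) g = cinner f (J1 g)"
    and J2: "bounded_clinear J2" "\<And>f g. cinner (J2 f) g = cinner f (J2 g)"
    and bounded_P1: "\<And>\<mu>. bounded_clinear (P1 \<mu>)"
    and bounded_P2: "\<And>\<mu>. bounded_clinear (P2 \<mu>)"
    and \<kappa>1_pos: "\<And>\<mu>. \<kappa>1 \<mu> > 0"
    and \<kappa>2_pos: "\<And>\<mu>. \<kappa>2 \<mu> > 0"
    and commute_P1: "\<And>\<mu>. op_graph T1 O fun_graph (P1 \<mu>) \<subseteq> fun_graph (P1 \<mu>) O op_graph T1"
    and commute_P2: "\<And>\<mu>. op_graph T2 O fun_graph (P2 \<mu>) \<subseteq> fun_graph (P2 \<mu>) O op_graph T2"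
    and definite_P1: "\<And>\<mu> f. f \<in> range (P1 \<mu>) \<Longrightarrow>
      \<kappa>1 \<mu> * (norm f)\<^sup>2 \<le> Re (cinner (sign_value \<mu> *\<^sub>R J1 f) f)"
    and definite_P2: "\<And>\<mu> f. f \<in> range (P2 \<mu>) \<Longrightarrow>
      \<kappa>2 \<mu> * (norm f)\<^sup>2 \<le> Re (cinner (sign_value \<mu> *\<^sub>R J2 f) f)"
begin

abbreviation "J \<equiv> tensor_bounded tens J1 J2"
abbreviation "S \<equiv> op_tensor_sum tens T1 T2"
abbreviation "Spart \<equiv> S_part tens T1 T2 P1 P2"
abbreviation "Ssgn \<equiv> S_sign tens T1 T2 P1 P2"
abbreviation "Srest \<equiv> S_rest tens T1 T2 P1 P2"

definition Q :: "part \<Rightarrow> part \<Rightarrow> 'c \<Rightarrow> 'c"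
  where "Q \<mu> \<nu> = tensor_bounded tens (part_proj P1 \<mu>) (part_proj P2 \<nu>)"

definition Qsgn :: "sign \<Rightarrow> 'c \<Rightarrow> 'c"
  where "Qsgn \<mu> h = (case \<mu> of
      Pos \<Rightarrow> Q (Sgn Pos) (Sgn Pos) h + Q (Sgn Neg) (Sgn Neg) h
    | Neg \<Rightarrow> Q (Sgn Pos) (Sgn Neg) h + Q (Sgn Neg) (Sgn Pos) h)"

definition Qrest :: "'c \<Rightarrow> 'c"
  where "Qrest h = Q Rest (Sgn Pos) h + Q Rest (Sgn Neg) h + Q Rest Rest h
    + Q (Sgn Pos) Rest h + Q (Sgn Neg) Rest h"

lemma J: "bounded_clinear J"
  by (rule bounded_clinear_tensor_bounded[OF J1(1) J2(1)])

lemma part: "bounded_clinear (part_proj P1 \<mu>)" "bounded_clinear (part_proj P2 \<mu>)"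
  by (intro bounded_clinear_part_proj bounded_P1 bounded_P2)+

lemma Q: "bounded_clinear (Q \<mu> \<nu>)"
  and Q_tens: "Q \<mu> \<nu> (tens f g) = tens (part_proj P1 \<mu> f) (part_proj P2 \<nu> g)"
  unfolding Q_def
  by (rule bounded_clinear_tensor_bounded[OF part], rule tensor_bounded_tens[OF part])

lemma part_Sgn: "part_proj P1 (Sgn \<mu>) = P1 \<mu>" "part_proj P2 (Sgn \<mu>) = P2 \<mu>"
  by (simp_all add: fun_eq_iff)

lemma comp: "compresses (Q \<mu> \<nu>) S (Spart \<mu> \<nu>)"
  unfolding S_part_def
  by (rule compresses_op_tensor_sum[OF Q Q_tens part_proj_graph[OF T1(2) commute_P1] _
        part_proj_graph[OF T2(2) commute_P2]])
    (auto simp: part_op_def op_restrict_def)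

lemma comp_sgn: "compresses (Qsgn \<mu>) S (Ssgn \<mu>)"
  unfolding S_sign_def Qsgn_def[abs_def] Let_def
  by (cases \<mu>) (simp_all add: compresses_dsum comp)

lemma comp_rest: "compresses Qrest S Srest"
  unfolding S_rest_def Qrest_def[abs_def] Let_def
  by (intro compresses_dsum comp)

lemma Qsgn: "bounded_clinear (Qsgn \<mu>)"
  using comp_sgn unfolding compresses_def by blast

lemma Qrest: "bounded_clinear Qrest"
  using comp_rest unfolding compresses_def by blast

text \<open>Both sides are bounded and linear, so simple tensors suffice. There the nine terms
  expand the product of the decompositions of \<open>f\<close> and \<open>g\<close>, whose three
  parts add up because \<open>Rest\<close> is defined as the remainder.\<close>

lemma resolution: "Qsgn Pos h + Qsgn Neg h + Qrest h = h"
proof -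
  have "(\<lambda>h. Qsgn Pos h + Qsgn Neg h + Qrest h) = (\<lambda>h. h)"
  proof (rule bounded_clinear_eqI)
    fix f g
    show "Qsgn Pos (tens f g) + Qsgn Neg (tens f g) + Qrest (tens f g) = tens f g"
      by (simp add: Qsgn_def Qrest_def Q_tens tens_diff_left tens_diff_right)
  qed (intro bounded_clinear_add bounded_clinear_ident Qsgn Qrest)+
  then show ?thesis
    by (rule fun_cong)
qed

text \<open>Membership in \<open>app_spectrum S\<close> belongs to the definition of
  \<open>def_spectrum\<close>; this inclusion and the next one supply it.\<close>

lemma Spart_subset: "op_graph (Spart \<mu> \<nu>) \<subseteq> op_graph S"
  unfolding S_part_def
  by (rule op_tensor_sum_mono) (auto simp: part_op_def op_restrict_def T1(1) T2(1))

lemma Ssgn_subset: "op_graph (Ssgn \<mu>) \<subseteq> op_graph S"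
  using Spart_subset unfolding S_sign_def Let_def
  by (cases \<mu>) (simp_all add: op_dsum_subset_op_tensor_sum)

text \<open>Each involution is multiplied by the sign of its own block, which makes both factors
  positive; the two signs then leave the tensor product as one factor.\<close>

lemma lower_bound:
  "\<kappa>1 \<mu> * \<kappa>2 \<nu> * (norm (Q (Sgn \<mu>) (Sgn \<nu>) h))\<^sup>2
    \<le> sign_value \<mu> * sign_value \<nu> * Re (cinner (J (Q (Sgn \<mu>) (Sgn \<nu>) h)) (Q (Sgn \<mu>) (Sgn \<nu>) h))"
proof -
  have "\<kappa>1 \<mu> * \<kappa>2 \<nu> * (norm (Q (Sgn \<mu>) (Sgn \<nu>) h))\<^sup>2
      \<le> Re (cinner (tensor_bounded tens (\<lambda>f. sign_value \<mu> *\<^sub>R J1 f) (\<lambda>g. sign_value \<nu> *\<^sub>R J2 g)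
          (Q (Sgn \<mu>) (Sgn \<nu>) h)) (Q (Sgn \<mu>) (Sgn \<nu>) h))"
    unfolding Q_def part_Sgn
    by (rule tensor_lower_bound)
      (intro bounded_clinear_scaleR hermitian_scaleR J1 J2 bounded_P1 bounded_P2
        definite_P1 definite_P2 less_imp_le \<kappa>1_pos \<kappa>2_pos; assumption)+
  then show ?thesis
    by (simp add: tensor_bounded_scaleR[OF J1(1) J2(1)] cinner_scaleR_left)
qed

text \<open>The common core of (i) and (ii): the block \<open>\<mu>\<close>, \<open>\<nu>\<close>
  survives, the block \<open>\<mu>'\<close>, \<open>\<nu>'\<close> is its companion of the same
  sign, and \<open>\<rho>'\<close> is the opposite sign. The assumption \<open>split\<close> states
  this pairing independently of the order of summands, so that all four cases fit.\<close>

lemma isolated: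
  assumes sign: "sign_value \<mu> * sign_value \<nu> = sign_value \<rho>"
    and z: "z \<in> app_spectrum (Spart (Sgn \<mu>) (Sgn \<nu>))"
    and res: "z \<notin> spectrum (Spart (Sgn \<mu>') (Sgn \<nu>'))" "z \<notin> spectrum (Ssgn \<rho>')" "z \<notin> spectrum Srest"
    and split: "\<And>h. Q (Sgn \<mu>) (Sgn \<nu>) h + Q (Sgn \<mu>') (Sgn \<nu>') h + Qsgn \<rho>' h = Qsgn Pos h + Qsgn Neg h"
  shows "z \<in> def_spectrum \<rho> J S"
proof (rule def_spectrumI[OF J Q])
  show "z \<in> app_spectrum S"
    using z app_spectrum_mono[OF Spart_subset] by blast
  show "(\<lambda>n. f n - Q (Sgn \<mu>) (Sgn \<nu>) (f n)) \<longlonglongrightarrow> 0" if f: "approx_eigenseq S z f" for f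
  proof -
    have "f n - Q (Sgn \<mu>) (Sgn \<nu>) (f n) = Q (Sgn \<mu>') (Sgn \<nu>') (f n) + Qsgn \<rho>' (f n) + Qrest (f n)" for n
      using resolution[of "f n"] unfolding split[symmetric] by (simp add: diff_eq_eq add_ac)
    moreover have "(\<lambda>n. Q (Sgn \<mu>') (Sgn \<nu>') (f n) + Qsgn \<rho>' (f n) + Qrest (f n)) \<longlonglongrightarrow> 0 + 0 + 0"
      by (intro tendsto_add approx_eigenseq_compress_tendsto_zero[OF comp res(1) f]
          approx_eigenseq_compress_tendsto_zero[OF comp_sgn res(2) f]
          approx_eigenseq_compress_tendsto_zero[OF comp_rest res(3) f])
    ultimately show ?thesis
      by simp
  qed
  show "0 < \<kappa>1 \<mu> * \<kappa>2 \<nu>"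
    using \<kappa>1_pos \<kappa>2_pos by simp
  show "\<kappa>1 \<mu> * \<kappa>2 \<nu> * (norm (Q (Sgn \<mu>) (Sgn \<nu>) h))\<^sup>2 \<le>
      sign_value \<rho> * Re (cinner (J (Q (Sgn \<mu>) (Sgn \<nu>) h)) (Q (Sgn \<mu>) (Sgn \<nu>) h))" for h
    using lower_bound unfolding sign[symmetric] .
qed

lemma app_spectrum_diagonal_part:
  assumes "\<mu> \<noteq> \<nu>"
  shows "app_spectrum (Spart (Sgn \<mu>) (Sgn \<mu>))
      - (spectrum (Ssgn Neg) \<union> spectrum Srest \<union> spectrum (Spart (Sgn \<nu>) (Sgn \<nu>))) \<subseteq> def_spectrum Pos J S"
  using assms by (cases \<mu>; cases \<nu>; intro subsetI isolated) (auto simp: Qsgn_def)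

lemma app_spectrum_mixed_part:
  assumes "\<mu> \<noteq> \<nu>"
  shows "app_spectrum (Spart (Sgn \<mu>) (Sgn \<nu>))
      - (spectrum (Ssgn Pos) \<union> spectrum Srest \<union> spectrum (Spart (Sgn \<nu>) (Sgn \<mu>))) \<subseteq> def_spectrum Neg J S"
  using assms by (cases \<mu>; cases \<nu>; intro subsetI isolated) (auto simp: Qsgn_def)

text \<open>For either sign the two surviving blocks pair \<open>Pos\<close> with
  \<open>\<mu>\<close> and \<open>Neg\<close> with \<open>\<nu>\<close>. Multiplying
  \<open>J1\<close> alone by the sign of \<open>\<mu>\<close> makes the form positive on both, so
  \<open>tensor_lower_bound_pair\<close> treats the two signs at once.\<close>

lemma lower_bound_sgn:
  assumes ne: "\<mu> \<noteq> \<nu>"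
    and k: "0 \<le> k" "\<forall>f\<in>range (P1 Pos). \<forall>g\<in>range (P1 Neg). cmod (cinner (J1 f) g) \<le> k * norm f * norm g"
    and l: "0 \<le> l" "\<forall>f\<in>range (P2 Pos). \<forall>g\<in>range (P2 Neg). cmod (cinner (J2 f) g) \<le> l * norm f * norm g"
    and small: "(k * l)\<^sup>2 < \<kappa>1 Pos * \<kappa>2 Pos * \<kappa>1 Neg * \<kappa>2 Neg"
  shows "\<exists>c>0. \<forall>h. c * (norm (Qsgn \<mu> h))\<^sup>2 \<le> sign_value \<mu> * Re (cinner (J (Qsgn \<mu> h)) (Qsgn \<mu> h))"
proof -
  have Qsgn_eq: "Qsgn \<mu> h = tensor_bounded tens (P1 Pos) (P2 \<mu>) h + tensor_bounded tens (P1 Neg) (P2 \<nu>) h" for h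
    using ne by (cases \<mu>; cases \<nu>) (simp_all add: Qsgn_def Q_def part_Sgn)
  have scaled: "tensor_bounded tens (\<lambda>f. sign_value \<mu> *\<^sub>R J1 f) J2 h = sign_value \<mu> *\<^sub>R J h" for h
    using tensor_bounded_scaleR[OF J1(1) J2(1), of "sign_value \<mu>" 1 h] by simp
  have abs: "\<bar>sign_value \<mu>\<bar> = 1"
    by (cases \<mu>) simp_all
  have "\<exists>c>0. \<forall>h. c * (norm (tensor_bounded tens (P1 Pos) (P2 \<mu>) h + tensor_bounded tens (P1 Neg) (P2 \<nu>) h))\<^sup>2
      \<le> Re (cinner (tensor_bounded tens (\<lambda>f. sign_value \<mu> *\<^sub>R J1 f) J2
          (tensor_bounded tens (P1 Pos) (P2 \<mu>) h + tensor_bounded tens (P1 Neg) (P2 \<nu>) h))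
        (tensor_bounded tens (P1 Pos) (P2 \<mu>) h + tensor_bounded tens (P1 Neg) (P2 \<nu>) h))"
  proof (rule tensor_lower_bound_pair)
    show "cmod (cinner (sign_value \<mu> *\<^sub>R J1 u) v) \<le> k * norm u * norm v"
      if "u \<in> range (P1 Pos)" "v \<in> range (P1 Neg)" for u v
      using k(2)[THEN bspec, OF that(1), THEN bspec, OF that(2)]
      by (simp add: cinner_scaleR_left norm_mult abs)
    show "cmod (cinner (J2 u) v) \<le> l * norm u * norm v"
      if "u \<in> range (P2 \<mu>)" "v \<in> range (P2 \<nu>)" for u v
    proof (cases \<mu>)
      case Pos
      then show ?thesis
        using l(2) that ne by (cases \<nu>) auto
    next
      case Neg
      \<comment> \<open>For \<open>Neg\<close> the second factor meets its two subspaces in reverse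
        order; symmetry of \<open>J2\<close> restores the order of the hypothesis
        \<open>l\<close>.\<close>
      have "cmod (cinner (J2 u) v) = cmod (cinner (J2 v) u)"
        by (metis J2(2) cinner_commute complex_mod_cnj)
      then show ?thesis
        using l(2) that ne Neg by (cases \<nu>) (auto simp: mult_ac)
    qed
    show "\<kappa>1 Pos * \<kappa>2 \<mu> * (norm (tensor_bounded tens (P1 Pos) (P2 \<mu>) h))\<^sup>2
        \<le> Re (cinner (tensor_bounded tens (\<lambda>f. sign_value \<mu> *\<^sub>R J1 f) J2
            (tensor_bounded tens (P1 Pos) (P2 \<mu>) h)) (tensor_bounded tens (P1 Pos) (P2 \<mu>) h))" for h
      using lower_bound[of Pos \<mu> h] by (simp add: Q_def part_Sgn scaled cinner_scaleR_left)
    show "\<kappa>1 Neg * \<kappa>2 \<nu> * (norm (tensor_bounded tens (P1 Neg) (P2 \<nu>) h))\<^sup>2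
        \<le> Re (cinner (tensor_bounded tens (\<lambda>f. sign_value \<mu> *\<^sub>R J1 f) J2
            (tensor_bounded tens (P1 Neg) (P2 \<nu>) h)) (tensor_bounded tens (P1 Neg) (P2 \<nu>) h))" for h
    proof -
      have "sign_value Neg * sign_value \<nu> = sign_value \<mu>"
        using ne by (cases \<mu>; cases \<nu>) simp_all
      then show ?thesis
        using lower_bound[of Neg \<nu> h] by (simp only: Q_def part_Sgn scaled cinner_scaleR_left)
          (simp add: mult.assoc)
    qed
    \<comment> \<open>Both pairings of blocks produce the same product of all four constants, which
      is why one smallness condition covers both signs.\<close>
    show "(k * l)\<^sup>2 < \<kappa>1 Pos * \<kappa>2 \<mu> * (\<kappa>1 Neg * \<kappa>2 \<nu>)"
      using small ne by (cases \<mu>; cases \<nu>) (simp_all add: mult_ac)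
  qed (intro bounded_clinear_scaleR hermitian_scaleR J1 J2 bounded_P1 bounded_P2
      mult_pos_pos \<kappa>1_pos \<kappa>2_pos k l)+
  then show ?thesis
    unfolding Qsgn_eq[symmetric] scaled by (simp add: cinner_scaleR_left)
qed

lemma app_spectrum_sgn:
  assumes ne: "\<mu> \<noteq> \<nu>"
    and k: "0 \<le> k" "\<forall>f\<in>range (P1 Pos). \<forall>g\<in>range (P1 Neg). cmod (cinner (J1 f) g) \<le> k * norm f * norm g"
    and l: "0 \<le> l" "\<forall>f\<in>range (P2 Pos). \<forall>g\<in>range (P2 Neg). cmod (cinner (J2 f) g) \<le> l * norm f * norm g"
    and small: "(k * l)\<^sup>2 < \<kappa>1 Pos * \<kappa>2 Pos * \<kappa>1 Neg * \<kappa>2 Neg"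
  shows "app_spectrum (Ssgn \<mu>) - (spectrum (Ssgn \<nu>) \<union> spectrum Srest) \<subseteq> def_spectrum \<mu> J S"
proof
  fix z
  assume "z \<in> app_spectrum (Ssgn \<mu>) - (spectrum (Ssgn \<nu>) \<union> spectrum Srest)"
  then have z: "z \<in> app_spectrum (Ssgn \<mu>)" "z \<notin> spectrum (Ssgn \<nu>)" "z \<notin> spectrum Srest"
    by auto
  obtain c where c: "0 < c"
      "\<And>h. c * (norm (Qsgn \<mu> h))\<^sup>2 \<le> sign_value \<mu> * Re (cinner (J (Qsgn \<mu> h)) (Qsgn \<mu> h))"
    using lower_bound_sgn[OF assms] by blast
  show "z \<in> def_spectrum \<mu> J S"
  proof (rule def_spectrumI[OF J Qsgn _ _ c])
    show "z \<in> app_spectrum S"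
      using z(1) app_spectrum_mono[OF Ssgn_subset] by blast
    show "(\<lambda>n. f n - Qsgn \<mu> (f n)) \<longlonglongrightarrow> 0" if f: "approx_eigenseq S z f" for f
    proof -
      have "Qsgn \<mu> h + Qsgn \<nu> h + Qrest h = h" for h
        using resolution[of h] ne by (cases \<mu>; cases \<nu>) (simp_all add: add_ac)
      then have "f n - Qsgn \<mu> (f n) = Qsgn \<nu> (f n) + Qrest (f n)" for n
        by (simp add: diff_eq_eq add_ac)
      moreover have "(\<lambda>n. Qsgn \<nu> (f n) + Qrest (f n)) \<longlonglongrightarrow> 0 + 0"
        by (intro tendsto_add approx_eigenseq_compress_tendsto_zero[OF comp_sgn z(2) f]
            approx_eigenseq_compress_tendsto_zero[OF comp_rest z(3) f])
      ultimately show ?thesis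
        by simp
    qed
  qed
qed

end

theorem theorem2p5:
  fixes tens :: "'a::chilbert_space \<Rightarrow> 'b::chilbert_space \<Rightarrow> 'c::chilbert_space"
    and T1 :: "'a operator" and T2 :: "'b operator"
    and J1 :: "'a \<Rightarrow> 'a" and J2 :: "'b \<Rightarrow> 'b"
    and P1 :: "sign \<Rightarrow> 'a \<Rightarrow> 'a" and P2 :: "sign \<Rightarrow> 'b \<Rightarrow> 'b"
    and \<kappa>1 \<kappa>2 :: "sign \<Rightarrow> real"
  assumes tensor: "hilbert_tensor_product tens"
    and T1: "op_space T1 = UNIV" "m_sectorial T1"
    and T2: "op_space T2 = UNIV" "m_sectorial T2"
    and J1: "symmetric_involution J1"
    and J2: "symmetric_involution J2"
    and bounded_P1: "\<And>\<mu>. bounded_clinear (P1 \<mu>)"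
    and bounded_P2: "\<And>\<mu>. bounded_clinear (P2 \<mu>)"
    and \<kappa>1_pos: "\<And>\<mu>. \<kappa>1 \<mu> > 0"
    and \<kappa>2_pos: "\<And>\<mu>. \<kappa>2 \<mu> > 0"
    and proj_P1: "\<And>\<mu> \<nu>. P1 \<mu> \<circ> P1 \<nu> = (if \<mu> = \<nu> then P1 \<mu> else (\<lambda>_. 0))"
    and proj_P2: "\<And>\<mu> \<nu>. P2 \<mu> \<circ> P2 \<nu> = (if \<mu> = \<nu> then P2 \<mu> else (\<lambda>_. 0))"
    and commute_P1: "\<And>\<mu>. op_graph T1 O fun_graph (P1 \<mu>) \<subseteq> fun_graph (P1 \<mu>) O op_graph T1"
    and commute_P2: "\<And>\<mu>. op_graph T2 O fun_graph (P2 \<mu>) \<subseteq> fun_graph (P2 \<mu>) O op_graph T2"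
    and pos_P1: "\<And>f. f \<in> range (P1 Pos) \<Longrightarrow> Re (cinner (J1 f) f) \<ge> \<kappa>1 Pos * (norm f)\<^sup>2"
    and neg_P1: "\<And>f. f \<in> range (P1 Neg) \<Longrightarrow> - Re (cinner (J1 f) f) \<ge> \<kappa>1 Neg * (norm f)\<^sup>2"
    and pos_P2: "\<And>f. f \<in> range (P2 Pos) \<Longrightarrow> Re (cinner (J2 f) f) \<ge> \<kappa>2 Pos * (norm f)\<^sup>2"
    and neg_P2: "\<And>f. f \<in> range (P2 Neg) \<Longrightarrow> - Re (cinner (J2 f) f) \<ge> \<kappa>2 Neg * (norm f)\<^sup>2"
  shows
    "let J = tensor_bounded tens J1 J2;
         S = op_tensor_sum tens T1 T2;
         SS = (\<lambda>\<mu> \<nu>. S_part tens T1 T2 P1 P2 (Sgn \<mu>) (Sgn \<nu>));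
         Ssgn = S_sign tens T1 T2 P1 P2;
         Srest = S_rest tens T1 T2 P1 P2
     in (\<forall>\<mu> \<nu>. \<mu> \<noteq> \<nu> \<longrightarrow>
           app_spectrum (SS \<mu> \<mu>) - (spectrum (Ssgn Neg) \<union> spectrum Srest \<union> spectrum (SS \<nu> \<nu>))
             \<subseteq> def_spectrum Pos J S) \<and>
        (\<forall>\<mu> \<nu>. \<mu> \<noteq> \<nu> \<longrightarrow>
           app_spectrum (SS \<mu> \<nu>) - (spectrum (Ssgn Pos) \<union> spectrum Srest \<union> spectrum (SS \<nu> \<mu>))
             \<subseteq> def_spectrum Neg J S) \<and>
        ((\<exists>\<kappa>1' \<kappa>2' :: real.
            \<kappa>1' \<ge> 0 \<and> \<kappa>2' \<ge> 0 \<and>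
            (\<forall>f \<in> range (P1 Pos). \<forall>g \<in> range (P1 Neg).
               cmod (cinner (J1 f) g) \<le> \<kappa>1' * norm f * norm g) \<and>
            (\<forall>f \<in> range (P2 Pos). \<forall>g \<in> range (P2 Neg).
               cmod (cinner (J2 f) g) \<le> \<kappa>2' * norm f * norm g) \<and>
            (\<kappa>1' * \<kappa>2')\<^sup>2 < \<kappa>1 Pos * \<kappa>2 Pos * \<kappa>1 Neg * \<kappa>2 Neg) \<longrightarrow>
         (\<forall>\<mu> \<nu>. \<mu> \<noteq> \<nu> \<longrightarrow>
            app_spectrum (Ssgn \<mu>) - (spectrum (Ssgn \<nu>) \<union> spectrum Srest)
              \<subseteq> def_spectrum \<mu> J S))"
proof -
  have loc: "definite_decomposition tens T1 T2 J1 J2 P1 P2 \<kappa>1 \<kappa>2"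
  proof unfold_locales
    show "linear_operator T1" "linear_operator T2"
      using T1(2) T2(2) unfolding m_sectorial_def closed_operator_def by blast+
    show "bounded_clinear J1" "bounded_clinear J2"
      "cinner (J1 f) g = cinner f (J1 g)" "cinner (J2 f') g' = cinner f' (J2 g')" for f g f' g'
      using J1 J2 unfolding symmetric_involution_def by blast+
    show "\<kappa>1 \<mu> * (norm f)\<^sup>2 \<le> Re (cinner (sign_value \<mu> *\<^sub>R J1 f) f)" if "f \<in> range (P1 \<mu>)" for \<mu> f
      by (rule sign_lower_bound[where P = P1, OF pos_P1 neg_P1 that])
    show "\<kappa>2 \<mu> * (norm f)\<^sup>2 \<le> Re (cinner (sign_value \<mu> *\<^sub>R J2 f) f)" if "f \<in> range (P2 \<mu>)" for \<mu> f
      by (rule sign_lower_bound[where P = P2, OF pos_P2 neg_P2 that])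
  qed (intro tensor T1 T2 bounded_P1 bounded_P2 \<kappa>1_pos \<kappa>2_pos commute_P1 commute_P2)+
  show ?thesis
    unfolding Let_def
  proof (intro conjI allI impI)
    fix \<mu> \<nu> :: sign assume ne: "\<mu> \<noteq> \<nu>" and "\<exists>\<kappa>1' \<kappa>2' :: real. \<kappa>1' \<ge> 0 \<and> \<kappa>2' \<ge> 0 \<and>
        (\<forall>f \<in> range (P1 Pos). \<forall>g \<in> range (P1 Neg). cmod (cinner (J1 f) g) \<le> \<kappa>1' * norm f * norm g) \<and>
        (\<forall>f \<in> range (P2 Pos). \<forall>g \<in> range (P2 Neg). cmod (cinner (J2 f) g) \<le> \<kappa>2' * norm f * norm g) \<and>
        (\<kappa>1' * \<kappa>2')\<^sup>2 < \<kappa>1 Pos * \<kappa>2 Pos * \<kappa>1 Neg * \<kappa>2 Neg"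
    then show "app_spectrum (S_sign tens T1 T2 P1 P2 \<mu>)
        - (spectrum (S_sign tens T1 T2 P1 P2 \<nu>) \<union> spectrum (S_rest tens T1 T2 P1 P2))
        \<subseteq> def_spectrum \<mu> (tensor_bounded tens J1 J2) (op_tensor_sum tens T1 T2)"
      by (elim exE conjE) (rule definite_decomposition.app_spectrum_sgn[OF loc ne])
  qed (rule definite_decomposition.app_spectrum_diagonal_part[OF loc]
      definite_decomposition.app_spectrum_mixed_part[OF loc]; assumption)+
qed

end
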